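(* Let $K\subseteq\mathbb C$ be compact and $\varphi\in R(K)$. The following assertions are equivalent: (1) $\varphi$ is a generator for $R(K)$; that is, $R(K)=[\varphi]_{\rm alg}$; (2) $\varphi$ is a homeomorphism of $K$ onto $\varphi(K)$ and $\mathbb C\setminus K$ is connected.
   Context: $R(K)$ is the uniform closure in $C(K)$ (complex-valued continuous functions on $K$) of the set of restrictions to $K$ of rational functions without poles on $K$. $[\varphi]_{\rm alg}$ denotes the closed subalgebra generated by $\varphi$, i.e. the uniform closure on $K$ of $\{p\circ\varphi: p\in\mathbb C[z]\}$ (constants included). *)

theory Defs
  imports "HOL-Analysis.Analysis" "HOL-Computational_Algebra.Polynomial"
begin

text \<open>
  \<open>C(K)\<close> with the supremum metric. Its points are the continuous functions on \<open>K\<close>, represented by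
  functions in \<open>extensional K\<close>, so that equality in \<open>C(K)\<close> is equality in HOL. The library space
  \<open>cfunspace\<close> consists of bounded functions, which is no restriction for compact \<open>K\<close>.
\<close>

definition C_metric :: "complex set \<Rightarrow> (complex \<Rightarrow> complex) metric" where
  "C_metric K = cfunspace (top_of_set K) euclidean_metric"

definition uniform_closure :: "complex set \<Rightarrow> (complex \<Rightarrow> complex) set \<Rightarrow> (complex \<Rightarrow> complex) set" where
  "uniform_closure K A = mtopology_of (C_metric K) closure_of A"

text \<open>
  A rational function has no pole on \<open>K\<close> iff it is a quotient \<open>p / q\<close> of polynomials with \<open>q\<close>
  zero-free on \<open>K\<close> (take \<open>p\<close> and \<open>q\<close> coprime). For \<open>K = {}\<close> the condition on \<open>q\<close> is void, but then
  all functions coincide on \<open>K\<close>.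
\<close>

definition rational_restrictions :: "complex set \<Rightarrow> (complex \<Rightarrow> complex) set" where
  "rational_restrictions K =
     {restrict (\<lambda>z. poly p z / poly q z) K | p q. \<forall>z\<in>K. poly q z \<noteq> 0}"

definition R_algebra :: "complex set \<Rightarrow> (complex \<Rightarrow> complex) set" where
  "R_algebra K = uniform_closure K (rational_restrictions K)"

definition alg_closure :: "complex set \<Rightarrow> (complex \<Rightarrow> complex) \<Rightarrow> (complex \<Rightarrow> complex) set" where
  "alg_closure K \<phi> = uniform_closure K {restrict (\<lambda>z. poly p (\<phi> z)) K | p. True}"

definition generator_of_R :: "complex set \<Rightarrow> (complex \<Rightarrow> complex) \<Rightarrow> bool" where
  "generator_of_R K \<phi> \<longleftrightarrow> R_algebra K = alg_closure K \<phi>"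

lemma mspace_C_metric:
  assumes "compact K"
  shows "mspace (C_metric K) = {f \<in> extensional K. continuous_on K f}"
proof -
  have "bounded (f ` K)" if "continuous_on K f" for f :: "complex \<Rightarrow> complex"
    using assms that compact_continuous_image compact_imp_bounded by blast
  then show ?thesis
    using assms compactin_mspace_cfunspace[of "top_of_set K" "euclidean_metric :: complex metric"]
    by (auto simp: C_metric_def compactin_subtopology)
qed

text \<open>The closure in the supremum metric is indeed the set of uniform limits.\<close>

lemma uniform_closure_iff:
  assumes "compact K" "A \<subseteq> {f \<in> extensional K. continuous_on K f}"
  shows "f \<in> uniform_closure K A \<longleftrightarrow>
    f \<in> extensional K \<and> continuous_on K f \<and> (\<forall>e>0. \<exists>g\<in>A. \<forall>z\<in>K. dist (f z) (g z) < e)"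
proof -
  let ?M = "C_metric K"
  interpret M: Metric_space "mspace ?M" "mdist ?M"
    by (rule Metric_space_mspace_mdist)
  note sp = mspace_C_metric[OF assms(1)]
  have le: "mdist ?M f g \<le> e \<longleftrightarrow> (\<forall>z\<in>K. dist (f z) (g z) \<le> e)"
    if "f \<in> mspace ?M" "g \<in> mspace ?M" "e > 0" for f g e
  proof (cases "K = {}")
    case True
    then show ?thesis
      using that by (simp add: C_metric_def mdist_cfunspace_le)
  next
    case False
    then show ?thesis
      using that cfunspace_mdist_le[of f "top_of_set K" euclidean_metric g e]
      by (simp add: C_metric_def)
  qed
  have "f \<in> uniform_closure K A \<longleftrightarrow>
        f \<in> mspace ?M \<and> (\<forall>e>0. \<exists>g\<in>A. g \<in> mspace ?M \<and> mdist ?M f g < e)"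
    unfolding uniform_closure_def mtopology_of_def M.metric_closure_of
    by (auto simp: M.in_mball)
  also have "\<dots> \<longleftrightarrow> f \<in> mspace ?M \<and> (\<forall>e>0. \<exists>g\<in>A. \<forall>z\<in>K. dist (f z) (g z) < e)"
  proof (intro conj_cong refl iffI allI impI)
    fix e :: real
    assume f: "f \<in> mspace ?M" and "e > 0"
      and *: "\<forall>e>0. \<exists>g\<in>A. g \<in> mspace ?M \<and> mdist ?M f g < e"
    then obtain g where "g \<in> A" "g \<in> mspace ?M" "mdist ?M f g < e / 2"
      using half_gt_zero by blast
    with le[OF f, of g "e / 2"] \<open>e > 0\<close> have "\<forall>z\<in>K. dist (f z) (g z) \<le> e / 2"
      by simp
    with \<open>e > 0\<close> have "\<forall>z\<in>K. dist (f z) (g z) < e"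
      by fastforce
    with \<open>g \<in> A\<close> show "\<exists>g\<in>A. \<forall>z\<in>K. dist (f z) (g z) < e" by blast
  next
    fix e :: real
    assume f: "f \<in> mspace ?M" and "e > 0"
      and *: "\<forall>e>0. \<exists>g\<in>A. \<forall>z\<in>K. dist (f z) (g z) < e"
    then obtain g where g: "g \<in> A" "\<forall>z\<in>K. dist (f z) (g z) < e / 2"
      using half_gt_zero by blast
    then have gM: "g \<in> mspace ?M" using assms(2) sp by blast
    have "mdist ?M f g \<le> e / 2"
      using le[OF f gM, of "e / 2"] g(2) \<open>e > 0\<close> by (simp add: less_imp_le)
    with \<open>e > 0\<close> have "mdist ?M f g < e" by simp
    with g(1) gM show "\<exists>g\<in>A. g \<in> mspace ?M \<and> mdist ?M f g < e" by blast
  qed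
  finally show ?thesis by (simp add: sp conj_assoc)
qed

end

theory Submission
  imports Defs "HOL-Complex_Analysis.Complex_Analysis"
begin

text \<open>
  A generator \<open>\<phi>\<close> separates points because \<open>z\<close> lies in \<open>R(K)\<close>, hence is a homeomorphism. If \<open>w\<close> lay in
  a bounded component of the complement of \<open>\<phi>(K)\<close>, then \<open>1/(\<phi> - w)\<close> would belong to \<open>R(K) = [\<phi>]\<close>, giving a
  polynomial \<open>p\<close> with \<open>1 - (x - w) p(x)\<close> small on \<open>\<phi>(K)\<close> but equal to \<open>1\<close> at \<open>w\<close>, against the maximum
  principle. Connectedness of the complement passes between \<open>K\<close> and \<open>\<phi>(K)\<close> by Borsuk's criterion.

  Conversely, for \<open>f \<in> R(K)\<close> the function \<open>f \<circ> \<phi>\<^sup>-\<^sup>1\<close> is continuous on \<open>L = \<phi>(K)\<close> and, by invariance of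
  domain, holomorphic in its interior, so it is a uniform limit of polynomials by Mergelyan's theorem.

  Mergelyan's theorem is proved by contour integrals only. Rescale so that \<open>f\<close> varies by less than \<open>1\<close>
  over distances at most \<open>1\<close>, and replace \<open>f\<close> by a Lipschitz function \<open>F\<close> at bounded distance that equals
  \<open>f\<close> deep inside \<open>L\<close>. Cauchy integrals over the unit squares of a grid split \<open>F\<close> into uniformly bounded
  parts, each holomorphic off its square and zero for squares deep inside \<open>L\<close>. Near any other square there
  is a connected piece of the complement of \<open>L\<close> joining two points \<open>a\<close>, \<open>b\<close> at distance \<open>1\<close>; with \<open>c\<close> their
  midpoint, \<open>z - c - sqrt ((z - a) (z - b))\<close> is holomorphic off that piece, bounded near it, and a multiple
  of \<open>1/(z - c) + O(|z - c|\<^sup>-\<^sup>3)\<close> at infinity. Linear combinations of this function and its square match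
  each part up to \<open>O(|z - c|\<^sup>-\<^sup>3)\<close>, and the errors sum over the planar lattice to an absolute constant.
\<close>

section \<open>Uniform approximation by polynomials\<close>

text \<open>Functions are total and their values off \<open>L\<close> do not matter, so members of
  the uniform closure of the polynomials can be combined as plain lambda terms, without
  restrictions.\<close>

definition poly_approx :: "complex set \<Rightarrow> (complex \<Rightarrow> complex) \<Rightarrow> bool" where
  "poly_approx L f \<longleftrightarrow> (\<forall>e>0. \<exists>p. \<forall>z\<in>L. norm (f z - poly p z) < e)"

lemma poly_approx_poly: "poly_approx L (poly p)"
  unfolding poly_approx_def by (intro allI impI exI[of _ p]) auto

lemma poly_approx_const: "poly_approx L (\<lambda>z. c)"
  using poly_approx_poly[of L "[:c:]"] by (simp add: poly_approx_def)

lemma poly_approx_ident: "poly_approx L (\<lambda>z. z)"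
  using poly_approx_poly[of L "[:0, 1:]"] by (simp add: poly_approx_def)

lemma poly_approx_cong:
  assumes "\<And>z. z \<in> L \<Longrightarrow> f z = g z" "poly_approx L g"
  shows "poly_approx L f"
  using assms unfolding poly_approx_def by metis

lemma poly_approx_limit:
  assumes "\<And>e. e > 0 \<Longrightarrow> \<exists>g. poly_approx L g \<and> (\<forall>z\<in>L. norm (f z - g z) < e)"
  shows "poly_approx L f"
  unfolding poly_approx_def
proof (intro allI impI)
  fix e :: real assume "e > 0"
  then obtain g where g: "poly_approx L g" "\<forall>z\<in>L. norm (f z - g z) < e / 2"
    using assms half_gt_zero by blast
  then obtain p where "\<forall>z\<in>L. norm (g z - poly p z) < e / 2"
    using \<open>e > 0\<close> unfolding poly_approx_def by (meson half_gt_zero)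
  with g have "\<forall>z\<in>L. norm (f z - poly p z) < e"
    by (metis norm_diff_triangle_less field_sum_of_halves)
  then show "\<exists>p. \<forall>z\<in>L. norm (f z - poly p z) < e" ..
qed

lemma poly_approx_add:
  assumes "poly_approx L f" "poly_approx L g"
  shows "poly_approx L (\<lambda>z. f z + g z)"
  unfolding poly_approx_def
proof (intro allI impI)
  fix e :: real assume "e > 0"
  then obtain p q where p: "\<forall>z\<in>L. norm (f z - poly p z) < e / 2"
    and q: "\<forall>z\<in>L. norm (g z - poly q z) < e / 2"
    using assms unfolding poly_approx_def by (meson half_gt_zero)
  have "norm (f z + g z - poly (p + q) z) < e" if "z \<in> L" for z
  proof -
    have "norm ((f z - poly p z) + (g z - poly q z)) < e / 2 + e / 2"
      using p q that by (intro norm_add_less) auto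
    then show ?thesis by (simp add: algebra_simps)
  qed
  then show "\<exists>p. \<forall>z\<in>L. norm (f z + g z - poly p z) < e" by blast
qed

lemma poly_approx_bounded:
  assumes "compact L" "poly_approx L f"
  obtains B where "B > 0" "\<And>z. z \<in> L \<Longrightarrow> norm (f z) \<le> B"
proof -
  obtain p where p: "\<forall>z\<in>L. norm (f z - poly p z) < 1"
    using assms(2) unfolding poly_approx_def by (meson zero_less_one)
  have "bounded (poly p ` L)"
    using assms(1) by (intro compact_imp_bounded compact_continuous_image continuous_intros)
  then obtain B where B: "B > 0" "\<forall>z\<in>L. norm (poly p z) \<le> B"
    by (auto simp: bounded_pos)
  have "norm (f z) \<le> B + 1" if "z \<in> L" for z
  proof -
    have "norm (f z) \<le> norm (f z - poly p z) + norm (poly p z)"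
      by (metis diff_add_cancel norm_triangle_ineq)
    then show ?thesis using p B that by fastforce
  qed
  then show thesis using that[of "B + 1"] B by auto
qed

lemma poly_approx_mult:
  assumes "compact L" "poly_approx L f" "poly_approx L g"
  shows "poly_approx L (\<lambda>z. f z * g z)"
  unfolding poly_approx_def
proof (intro allI impI)
  fix e :: real assume "e > 0"
  obtain B where B: "B > 0" "\<And>z. z \<in> L \<Longrightarrow> norm (f z) \<le> B"
    using poly_approx_bounded assms by blast
  have "e / (2 * B) > 0" using \<open>e > 0\<close> B by simp
  then obtain q where q: "\<And>z. z \<in> L \<Longrightarrow> norm (g z - poly q z) < e / (2 * B)"
    using assms(3) unfolding poly_approx_def by blast
  \<comment> \<open>\<open>q\<close> is fixed before \<open>p\<close>: the tolerance for
    \<open>p\<close> depends on the bound \<open>C\<close> of \<open>q\<close> on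
    \<open>L\<close>.\<close>
  obtain C where C: "C > 0" "\<And>z. z \<in> L \<Longrightarrow> norm (poly q z) \<le> C"
    using poly_approx_bounded[OF assms(1) poly_approx_poly] by blast
  have "e / (2 * C) > 0" using \<open>e > 0\<close> C by simp
  then obtain p where p: "\<And>z. z \<in> L \<Longrightarrow> norm (f z - poly p z) < e / (2 * C)"
    using assms(2) unfolding poly_approx_def by blast
  have "norm (f z * g z - poly (p * q) z) < e" if "z \<in> L" for z
  proof -
    have "f z * g z - poly (p * q) z = f z * (g z - poly q z) + (f z - poly p z) * poly q z"
      by (simp add: algebra_simps)
    also have "norm \<dots> \<le> norm (f z) * norm (g z - poly q z) + norm (f z - poly p z) * norm (poly q z)"
      by (metis norm_mult norm_triangle_ineq)
    also have "\<dots> \<le> B * norm (g z - poly q z) + norm (f z - poly p z) * C"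
      using B(2)[OF that] C(2)[OF that] by (intro add_mono mult_mono) (use B C in auto)
    also have "\<dots> < B * (e / (2 * B)) + e / (2 * C) * C"
      using q[OF that] p[OF that] B C
      by (intro add_strict_mono mult_strict_left_mono mult_strict_right_mono)
    also have "\<dots> = e" using B C by (simp add: field_simps)
    finally show ?thesis .
  qed
  then show "\<exists>p. \<forall>z\<in>L. norm (f z * g z - poly p z) < e" by blast
qed

lemma poly_approx_cmult:
  "compact L \<Longrightarrow> poly_approx L f \<Longrightarrow> poly_approx L (\<lambda>z. c * f z)"
  by (intro poly_approx_mult poly_approx_const)

lemma poly_approx_diff:
  "compact L \<Longrightarrow> poly_approx L f \<Longrightarrow> poly_approx L g \<Longrightarrow> poly_approx L (\<lambda>z. f z - g z)"
  using poly_approx_add[of L f "\<lambda>z. (-1) * g z"] poly_approx_cmult[of L g "-1"] by simp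

lemma poly_approx_power:
  "compact L \<Longrightarrow> poly_approx L f \<Longrightarrow> poly_approx L (\<lambda>z. f z ^ n)"
  by (induction n) (auto intro: poly_approx_const poly_approx_mult)

lemma poly_approx_sum:
  "(\<And>i. i \<in> I \<Longrightarrow> poly_approx L (f i)) \<Longrightarrow> poly_approx L (\<lambda>z. \<Sum>i\<in>I. f i z)"
  by (induction I rule: infinite_finite_induct) (auto intro: poly_approx_const poly_approx_add)

text \<open>The Taylor series of \<open>h\<close> at 0 converges uniformly on the closed disc of
  radius \<open>r < 1\<close>, which contains the values of \<open>u\<close> on \<open>L\<close>;
  its partial sums at \<open>u\<close> are polynomials in \<open>u\<close>.\<close>

lemma poly_approx_compose_ball:
  assumes "compact L" "poly_approx L u" "r < 1" "\<And>z. z \<in> L \<Longrightarrow> norm (u z) \<le> r"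
    and hol: "h holomorphic_on ball 0 1"
  shows "poly_approx L (\<lambda>z. h (u z))"
proof (rule poly_approx_limit)
  fix e :: real assume "e > 0"
  define a where "a = (\<lambda>n. (deriv ^^ n) h 0 / fact n)"
  \<comment> \<open>A radius strictly between \<open>r\<close> and 1; the maximum keeps it positive
    even for negative \<open>r\<close>, which can occur when \<open>L\<close> is empty.\<close>
  define r' where "r' = (max r 0 + 1) / 2"
  have r': "r < r'" "r' < 1" "0 < r'" using assms(3) by (auto simp: r'_def)
  have sums: "(\<lambda>n. a n * (w - 0) ^ n) sums h w" if "w \<in> ball 0 1" for w
    using holomorphic_power_series[OF hol that] by (simp add: a_def)
  have "conv_radius a \<ge> ereal r'"
  proof -
    have "summable (\<lambda>n. a n * complex_of_real r' ^ n)"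
      using sums[of "of_real r'"] r' by (auto simp: sums_iff)
    from conv_radius_geI[OF this] show ?thesis using r' by simp
  qed
  then have "ereal r < conv_radius a"
    using r' by (meson ereal_less(2) less_ereal.simps(1) less_le_trans)
  from powser_uniform_limit[OF this, of 0] \<open>e > 0\<close>
  obtain n where n: "\<forall>w\<in>cball 0 r. dist (\<Sum>i<n. a i * (w - 0) ^ i) (\<Sum>i. a i * (w - 0) ^ i) < e"
    unfolding uniform_limit_iff eventually_sequentially by blast
  have "norm (h (u z) - (\<Sum>i<n. a i * u z ^ i)) < e" if "z \<in> L" for z
  proof -
    have "u z \<in> cball 0 r" "u z \<in> ball 0 1" using assms(3,4) that by force+
    then show ?thesis using n sums[of "u z"] by (fastforce simp: sums_iff dist_norm norm_minus_commute)
  qed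
  moreover have "poly_approx L (\<lambda>z. \<Sum>i<n. a i * u z ^ i)"
    using assms(1,2) by (intro poly_approx_sum poly_approx_cmult poly_approx_power)
  ultimately show "\<exists>g. poly_approx L g \<and> (\<forall>z\<in>L. norm (h (u z) - g z) < e)" by blast
qed

section \<open>Moving poles off to infinity\<close>

text \<open>Runge's pole shifting: \<open>1 / (z - b)\<close> is \<open>1 / (z - a)\<close> times a
  geometric series in \<open>(b - a) / (z - a)\<close>, whose norm on \<open>L\<close> is at most
  \<open>norm (b - a) / d < 1\<close>.\<close>

lemma poly_approx_inverse_near:
  assumes "compact L" "poly_approx L (\<lambda>z. 1 / (z - a))" "d > 0"
    and far: "\<And>z. z \<in> L \<Longrightarrow> d \<le> norm (z - a)" and b: "norm (b - a) < d"
  shows "poly_approx L (\<lambda>z. 1 / (z - b))"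
proof -
  let ?u = "\<lambda>z. (b - a) * (1 / (z - a))"
  have "poly_approx L (\<lambda>z. (1 / (z - a)) * (1 / (1 - ?u z)))"
  proof (intro poly_approx_mult poly_approx_compose_ball[where h = "\<lambda>w. 1 / (1 - w)" and r = "norm (b - a) / d"]
      poly_approx_cmult assms)
    show "norm (?u z) \<le> norm (b - a) / d" if "z \<in> L" for z
      using frac_le[OF norm_ge_zero order_refl \<open>d > 0\<close> far[OF that], of "b - a"] by (simp add: norm_divide)
    show "(\<lambda>w. 1 / (1 - w)) holomorphic_on ball 0 1"
      by (intro holomorphic_intros) auto
  qed (use b \<open>d > 0\<close> in \<open>auto intro: poly_approx_const\<close>)
  moreover have "1 / (z - b) = (1 / (z - a)) * (1 / (1 - ?u z))" if "z \<in> L" for z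
  proof -
    have "z - a \<noteq> 0" using far[OF that] \<open>d > 0\<close> by auto
    then show ?thesis by (simp add: field_simps)
  qed
  ultimately show ?thesis using poly_approx_cong by (metis (no_types, lifting))
qed

text \<open>A geometric series in \<open>z / a\<close>; this supplies the far pole at which the
  shifting starts.\<close>

lemma poly_approx_inverse_large:
  assumes "compact L" "\<And>z. z \<in> L \<Longrightarrow> norm z \<le> B" "B < norm a"
  shows "poly_approx L (\<lambda>z. 1 / (z - a))"
proof (cases "L = {}")
  case False
  then have "B \<ge> 0" using assms(2) norm_ge_zero order_trans by blast
  then have a: "a \<noteq> 0" using assms(3) by auto
  have "poly_approx L (\<lambda>z. (-1 / a) * (1 / (1 - (1 / a) * z)))"
  proof (intro poly_approx_cmult poly_approx_compose_ball[where h = "\<lambda>w. 1 / (1 - w)" and r = "B / norm a"]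
      poly_approx_ident assms)
    show "norm (1 / a * z) \<le> B / norm a" if "z \<in> L" for z
      using assms(2)[OF that] by (simp add: norm_mult norm_divide divide_right_mono)
    show "(\<lambda>w. 1 / (1 - w)) holomorphic_on ball 0 1"
      by (intro holomorphic_intros) auto
  qed (use assms a in auto)
  moreover have "1 / (z - a) = (-1 / a) * (1 / (1 - (1 / a) * z))" if "z \<in> L" for z
  proof -
    have "z \<noteq> a" using assms(2)[OF that] assms(3) by auto
    with a show ?thesis by (simp add: divide_simps)
  qed
  ultimately show ?thesis using poly_approx_cong by (metis (no_types, lifting))
qed (auto simp: poly_approx_def)

text \<open>Whether \<open>1 / (z - a)\<close> is approximable is locally constant in
  \<open>a\<close> off \<open>L\<close>, by pole shifting in both directions. As \<open>- L\<close>
  is connected, the answer is the one for a far pole.\<close>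

lemma poly_approx_inverse:
  assumes L: "compact L" "connected (- L)" and a: "a \<notin> L"
  shows "poly_approx L (\<lambda>z. 1 / (z - a))"
proof -
  obtain B where B: "B > 0" "\<And>z. z \<in> L \<Longrightarrow> norm z \<le> B"
    using compact_imp_bounded[OF L(1)] by (auto simp: bounded_pos)
  define b :: complex where "b = of_real (B + 1)"
  have nb: "norm b = B + 1" using B by (simp add: b_def del: of_real_add)
  then have b: "b \<in> - L" using B(2)[of b] by auto
  define P where "P = (\<lambda>a. poly_approx L (\<lambda>z. 1 / (z - a)))"
  have "P a \<longleftrightarrow> P b"
  proof (rule connected_equivalence_relation[OF L(2), where R = "\<lambda>a b. P a \<longleftrightarrow> P b"])
    fix c assume "c \<in> - L"
    then obtain d where "d > 0" and d: "ball c d \<subseteq> - L"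
      using compact_imp_closed[OF L(1)] open_contains_ball by blast
    have far: "d \<le> norm (z - c)" if "z \<in> L" for z
      using d that by (force simp: dist_norm norm_minus_commute)
    \<comment> \<open>Half the radius, so that \<open>x\<close> still has distance at least
      \<open>d / 2\<close> from \<open>L\<close> and the pole can also be moved back from
      \<open>x\<close> to \<open>c\<close>.\<close>
    have "P c \<longleftrightarrow> P x" if x: "norm (x - c) < d / 2" for x
    proof
      show "P c \<Longrightarrow> P x"
        unfolding P_def using poly_approx_inverse_near[OF L(1) _ \<open>d > 0\<close> far] x \<open>d > 0\<close> by force
      have "d / 2 \<le> norm (z - x)" if "z \<in> L" for z
        using far[OF that] x norm_triangle_ineq[of "z - x" "x - c"] by simp
      then show "P x \<Longrightarrow> P c"
        unfolding P_def using poly_approx_inverse_near[OF L(1), of x "d / 2" c] x \<open>d > 0\<close>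
        by (auto simp: norm_minus_commute)
    qed
    then show "\<exists>T. openin (top_of_set (- L)) T \<and> c \<in> T \<and> (\<forall>x\<in>T. P c \<longleftrightarrow> P x)"
      using \<open>d > 0\<close> subset_trans[OF subset_ball d, of "d / 2"]
      by (intro exI[of _ "ball c (d / 2)"])
         (auto simp: dist_norm norm_minus_commute intro!: open_subset)
  qed (use a b in auto)
  moreover have "P b" unfolding P_def using poly_approx_inverse_large[OF L(1) B(2)] nb by simp
  ultimately show ?thesis by (simp add: P_def)
qed

section \<open>A substitute for the analytic capacity of a continuum\<close>

text \<open>
  A branch \<open>s\<close> of the square root of \<open>(z - b) / (z - a)\<close>; the last conjunct, stated multiplicatively so
  that it is preserved by products, selects the branch that tends to \<open>1\<close> at infinity.
\<close>

definition sqrt_branch ::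
  "complex set \<Rightarrow> complex \<Rightarrow> real \<Rightarrow> complex \<Rightarrow> complex \<Rightarrow> complex set \<Rightarrow> (complex \<Rightarrow> complex) \<Rightarrow> bool" where
  "sqrt_branch L c r a b V s \<longleftrightarrow>
     open V \<and> L \<subseteq> V \<and> continuous_on V s \<and> poly_approx L s \<and>
     (\<forall>z\<in>V. (s z)\<^sup>2 * (z - a) = z - b) \<and>
     (\<forall>z\<in>V. r \<le> norm (z - c) \<longrightarrow> s z * csqrt (1 - (a - c) / (z - c)) = csqrt (1 - (b - c) / (z - c)))"

lemma Re_one_minus_pos: "norm (x :: complex) < 1 \<Longrightarrow> 0 < Re (1 - x)"
  using complex_Re_le_cmod[of x] by simp

lemma csqrt_mult_Re_pos:
  assumes "Re x > 0" "Re y > 0"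
  shows "csqrt (x * y) = csqrt x * csqrt y"
proof (rule csqrt_mult)
  have "\<bar>Arg x\<bar> < pi / 2" "\<bar>Arg y\<bar> < pi / 2"
    using assms by (metis Arg_Re_pos zero_complex.simps(1) less_irrefl)+
  then show "Arg x + Arg y \<in> {-pi<..pi}"
    by auto
qed

text \<open>On \<open>V\<close> the quotient
  \<open>(z - b) / (z - a) = 1 - (b - a) / (z - a)\<close> stays in the unit disc about 1, hence in
  the right half-plane, so its principal root serves as \<open>s\<close>.\<close>

lemma sqrt_branch_near:
  assumes L: "compact L" and a: "poly_approx L (\<lambda>z. 1 / (z - a))"
    and far: "d > 0" "\<And>z. z \<in> L \<Longrightarrow> d \<le> norm (z - a)" and b: "norm (b - a) < d"
    and r: "norm (a - c) < r" "norm (b - c) < r"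
  shows "\<exists>V s. sqrt_branch L c r a b V s"
proof -
  define V where "V = {z. norm (b - a) < norm (z - a)}"
  define s where "s = (\<lambda>z. csqrt (1 - (b - a) * (1 / (z - a))))"
  have small: "norm ((b - a) * (1 / (z - a))) < 1" if "z \<in> V" for z
  proof -
    have "z \<noteq> a" using that by (auto simp: V_def)
    then show ?thesis using that by (simp add: V_def norm_divide)
  qed
  have ne: "z \<noteq> a" if "z \<in> V" for z using that by (auto simp: V_def)
  have "open V"
    unfolding V_def by (intro open_Collect_less continuous_intros)
  moreover have "L \<subseteq> V" using far b by (force simp: V_def)
  moreover have "continuous_on V s"
    unfolding s_def
  proof (rule continuous_on_compose2[of "{w. Re w > 0}" csqrt])
    show "continuous_on {w. 0 < Re w} csqrt"
      by (intro holomorphic_on_imp_continuous_on holomorphic_on_subset[OF holomorphic_on_csqrt])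
        (auto simp: complex_nonpos_Reals_iff)
    show "continuous_on V (\<lambda>z. 1 - (b - a) * (1 / (z - a)))"
      using ne by (intro continuous_intros) auto
    show "(\<lambda>z. 1 - (b - a) * (1 / (z - a))) ` V \<subseteq> {w. 0 < Re w}"
      using Re_one_minus_pos[OF small] by blast
  qed
  moreover have "poly_approx L s"
    unfolding s_def
  proof (rule poly_approx_compose_ball[where h = "\<lambda>w. csqrt (1 - w)" and r = "norm (b - a) / d"])
    show "norm ((b - a) * (1 / (z - a))) \<le> norm (b - a) / d" if "z \<in> L" for z
      using frac_le[OF norm_ge_zero order_refl far(1) far(2)[OF that], of "b - a"]
      by (simp add: norm_divide)
    show "(\<lambda>w. csqrt (1 - w)) holomorphic_on ball 0 1"
      using Re_one_minus_pos by (intro holomorphic_intros) (force simp: complex_nonpos_Reals_iff)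
    show "poly_approx L (\<lambda>z. (b - a) * (1 / (z - a)))"
      by (intro poly_approx_cmult a L)
  qed (use L b far in auto)
  moreover have "(s z)\<^sup>2 * (z - a) = z - b" if "z \<in> V" for z
    using ne[OF that] by (simp add: s_def field_simps)
  moreover have "s z * csqrt (1 - (a - c) / (z - c)) = csqrt (1 - (b - c) / (z - c))"
    if "z \<in> V" "r \<le> norm (z - c)" for z
  proof -
    have "norm ((a - c) / (z - c)) < 1"
      using r that by (auto simp: norm_divide divide_less_eq)
    \<comment> \<open>Both radicands have positive real part, so the principal root is
      multiplicative on them.\<close>
    then have "s z * csqrt (1 - (a - c) / (z - c))
        = csqrt ((1 - (b - a) * (1 / (z - a))) * (1 - (a - c) / (z - c)))"
      unfolding s_def
      by (intro csqrt_mult_Re_pos[symmetric] Re_one_minus_pos small that)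
    also have "(1 - (b - a) * (1 / (z - a))) * (1 - (a - c) / (z - c)) = 1 - (b - c) / (z - c)"
    proof -
      have "z \<noteq> c" using r(1) that(2) norm_ge_zero[of "a - c"] by (metis diff_self norm_zero not_le order_trans)
      then show ?thesis using ne[OF that(1)] by (simp add: divide_simps)
    qed
    finally show ?thesis .
  qed
  ultimately show ?thesis unfolding sqrt_branch_def by blast
qed

text \<open>The quotients \<open>(z - b) / (z - a)\<close> and \<open>(z - e) / (z - b)\<close>
  multiply to \<open>(z - e) / (z - a)\<close>; the normalizations at infinity telescope in the same
  way.\<close>

lemma sqrt_branch_trans:
  assumes "compact L" "sqrt_branch L c r a b V s" "sqrt_branch L c r b e W t"
  shows "sqrt_branch L c r a e (V \<inter> W) (\<lambda>z. t z * s z)"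
  unfolding sqrt_branch_def
proof (intro conjI ballI impI)
  show "continuous_on (V \<inter> W) (\<lambda>z. t z * s z)"
    using assms unfolding sqrt_branch_def
    by (intro continuous_on_mult) (auto elim: continuous_on_subset)
  show "poly_approx L (\<lambda>z. t z * s z)"
    using assms unfolding sqrt_branch_def by (intro poly_approx_mult) auto
  show "(t z * s z)\<^sup>2 * (z - a) = z - e" if "z \<in> V \<inter> W" for z
    using assms that unfolding sqrt_branch_def
    by (metis IntD1 IntD2 mult.assoc power_mult_distrib)
  show "t z * s z * csqrt (1 - (a - c) / (z - c)) = csqrt (1 - (e - c) / (z - c))"
    if "z \<in> V \<inter> W" "r \<le> norm (z - c)" for z
    using assms that unfolding sqrt_branch_def by (metis IntD1 IntD2 mult.assoc)
qed (use assms in \<open>auto simp: sqrt_branch_def\<close>)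

text \<open>Short moves are covered by \<open>sqrt_branch_near\<close> and chained along
  \<open>U\<close> by the product rule. All intermediate points lie in \<open>ball c r\<close>, as
  the normalization on \<open>r \<le> norm (z - c)\<close> requires.\<close>

lemma sqrt_branch_connected:
  assumes L: "compact L" "connected (- L)"
    and U: "connected U" "open U" "U \<subseteq> - L" "U \<subseteq> ball c r" and ab: "a \<in> U" "b \<in> U"
  shows "\<exists>V s. sqrt_branch L c r a b V s"
proof -
  \<comment> \<open>Both directions are built in, because the connectedness argument needs a
    symmetric relation.\<close>
  define R where "R = (\<lambda>a b. (\<exists>V s. sqrt_branch L c r a b V s) \<and> (\<exists>V s. sqrt_branch L c r b a V s))"
  have "R a b"
  proof (rule connected_equivalence_relation[OF U(1) ab])
    show "R x z" if "R x y" "R y z" for x y z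
      using that sqrt_branch_trans[OF L(1)] unfolding R_def by blast
    fix p assume p: "p \<in> U"
    then obtain d where "d > 0" and d: "ball p d \<subseteq> U"
      using U(2) open_contains_ball by blast
    have far: "d \<le> norm (z - p)" if "z \<in> L" for z
      using d that U(3) by (force simp: dist_norm norm_minus_commute)
    have "R p x" if x: "norm (x - p) < d / 2" for x
    proof -
      have "x \<in> U" using x \<open>d > 0\<close> d by (force simp: dist_norm norm_minus_commute)
      have far': "d / 2 \<le> norm (z - x)" if "z \<in> L" for z
        using far[OF that] x norm_triangle_ineq[of "z - x" "x - p"] by simp
      have r: "norm (p - c) < r" "norm (x - c) < r"
        using p \<open>x \<in> U\<close> U(4) by (auto simp: dist_norm norm_minus_commute)
      have inv: "poly_approx L (\<lambda>z. 1 / (z - p))" "poly_approx L (\<lambda>z. 1 / (z - x))"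
        using p \<open>x \<in> U\<close> U(3) by (auto intro!: poly_approx_inverse L)
      show ?thesis
        unfolding R_def
      proof
        show "\<exists>V s. sqrt_branch L c r p x V s"
          using x \<open>d > 0\<close> by (intro sqrt_branch_near[OF L(1) inv(1) _ far _ r]) auto
        show "\<exists>V s. sqrt_branch L c r x p V s"
          using x \<open>d > 0\<close> by (intro sqrt_branch_near[OF L(1) inv(2) _ far' _ r(2,1)]) (auto simp: norm_minus_commute)
      qed
    qed
    then show "\<exists>T. openin (top_of_set U) T \<and> p \<in> T \<and> (\<forall>x\<in>T. R p x)"
      using \<open>d > 0\<close> subset_trans[OF subset_ball d, of "d / 2"]
      by (intro exI[of _ "ball p (d / 2)"])
         (auto simp: dist_norm norm_minus_commute intro!: open_subset)
  qed (auto simp: R_def)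
  then show ?thesis by (simp add: R_def)
qed

text \<open>The complement is connected and unbounded, so a path in it leads from \<open>w\<close>
  out of \<open>cball w 1\<close>. Its initial piece up to the unit circle about \<open>w\<close>
  lies in one component of \<open>- L \<inter> ball w 2\<close>.\<close>

lemma connected_complement_escape:
  fixes L :: "complex set"
  assumes L: "compact L" "connected (- L)" and w: "w \<notin> L"
  obtains U w' where "open U" "connected U" "U \<subseteq> - L" "U \<subseteq> ball w 2" "w \<in> U" "w' \<in> U" "norm (w' - w) = 1"
proof -
  have op: "open (- L)" using L(1) compact_imp_closed by blast
  have "\<not> bounded (- L)"
    using cobounded_imp_unbounded compact_imp_bounded[OF L(1)] by (metis double_complement)
  then have "\<not> - L \<subseteq> cball w 1" using bounded_subset bounded_cball by blast
  then obtain y where y: "y \<in> - L" "y \<notin> cball w 1" by blast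
  have "path_connected (- L)" using op L(2) connected_open_path_connected by blast
  then obtain g where g: "path g" "path_image g \<subseteq> - L" "pathstart g = w" "pathfinish g = y"
    using w y unfolding path_connected_def by (metis ComplI)
  obtain h where h: "path h" "pathstart h = w" "path_image h \<subseteq> path_image g \<inter> cball w 1"
      "pathfinish h \<in> frontier (cball w 1)"
    using exists_path_subpath_to_frontier_closed[OF closed_cball[of w 1] g(1)] g y by auto
  define U where "U = connected_component_set (- L \<inter> ball w 2) w"
  show thesis
  proof (rule that[of U "pathfinish h"])
    show "open U" unfolding U_def using op by (intro open_connected_component open_Int) auto
    show "connected U" unfolding U_def by simp
    have "U \<subseteq> - L \<inter> ball w 2" unfolding U_def by (rule connected_component_subset)
    then show "U \<subseteq> - L" "U \<subseteq> ball w 2" by auto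
    show "w \<in> U" unfolding U_def using w by simp
    have "path_image h \<subseteq> U"
      unfolding U_def
    proof (rule connected_component_maximal)
      show "w \<in> path_image h" using h by (metis pathstart_in_path_image)
      show "connected (path_image h)" using h by (simp add: connected_path_image)
      show "path_image h \<subseteq> - L \<inter> ball w 2"
        using h(3) g(2) by force
    qed
    then show "pathfinish h \<in> U" by auto
    show "norm (pathfinish h - w) = 1"
      using h(4) by (simp add: dist_norm norm_minus_commute)
  qed
qed

text \<open>With \<open>x = z - c\<close> and \<open>d\<close> half of \<open>w' - w\<close>, the
  expansion is \<open>x - sqrt (x^2 - d^2) = d^2 / (2 * x) + O(x^-3)\<close>. The factor
  \<open>2 / d^2\<close> makes the leading coefficient 1, and centring at the midpoint makes the
  expansion odd, so there is no term in \<open>x^-2\<close>.\<close>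

lemma capacity_function:
  assumes L: "compact L" "connected (- L)" and w: "w \<notin> L"
  obtains c V h where "norm (c - w) \<le> 1" "open V" "L \<subseteq> V" "continuous_on V h" "poly_approx L h"
    "\<And>z. z \<in> V \<Longrightarrow> norm (z - c) \<le> 12 \<Longrightarrow> norm (h z) \<le> 200"
    "\<And>z. z \<in> V \<Longrightarrow> 12 \<le> norm (z - c) \<Longrightarrow> norm (h z - 1 / (z - c)) \<le> 1 / norm (z - c) ^ 3"
proof -
  obtain U w' where U: "open U" "connected U" "U \<subseteq> - L" "U \<subseteq> ball w 2" "w \<in> U" "w' \<in> U"
    and w': "norm (w' - w) = 1"
    using connected_complement_escape[OF assms] .
  define c where "c = (w + w') / 2"
  define d where "d = (w' - w) / 2"
  have d: "norm d = 1 / 2" using w' by (simp add: d_def norm_divide)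
  then have d0: "d \<noteq> 0" by auto
  have wc: "w = c - d" "w' = c + d" by (simp_all add: c_def d_def field_simps)
  have "dist w c = 1 / 2" using d by (simp add: wc dist_norm)
  \<comment> \<open>\<open>w\<close> is at distance 1/2 from the midpoint, so the radius 3 is enough
    for the branch.\<close>
  then have "ball w 2 \<subseteq> ball c 3" by (subst ball_subset_ball_iff) auto
  then obtain V s where "sqrt_branch L c 3 w w' V s"
    using sqrt_branch_connected[OF L U(2,1,3), of c 3 w w'] U by blast
  then have V: "open V" "L \<subseteq> V" "continuous_on V s" "poly_approx L s"
    and sq: "\<And>z. z \<in> V \<Longrightarrow> (s z)\<^sup>2 * (z - w) = z - w'"
    and far: "\<And>z. z \<in> V \<Longrightarrow> 3 \<le> norm (z - c) \<Longrightarrow>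
       s z * csqrt (1 + d / (z - c)) = csqrt (1 - d / (z - c))"
    unfolding sqrt_branch_def by (auto simp: wc)
  define h where "h = (\<lambda>z. 2 / d\<^sup>2 * (z - c - (z - w) * s z))"
  show thesis
  proof (rule that[of c V h])
    show "norm (c - w) \<le> 1" using d by (simp add: wc)
    show "continuous_on V h" unfolding h_def by (intro continuous_intros V)
    show "poly_approx L h"
      unfolding h_def using L(1) V(4)
      by (intro poly_approx_cmult poly_approx_diff poly_approx_mult poly_approx_ident poly_approx_const) auto
  next
    fix z assume z: "z \<in> V" "norm (z - c) \<le> 12"
    have "norm (z - w) \<le> 25/2" "norm (z - w') \<le> 25/2"
      using norm_triangle_ineq[of "z - c" d] norm_triangle_ineq4[of "z - c" d] z d
      by (auto simp: wc algebra_simps)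
    then have "norm (z - w) * norm (z - w') \<le> 25/2 * (25/2)"
      by (intro mult_mono) auto
    \<comment> \<open>The square of \<open>(z - w) * s z\<close> is known whatever the branch, which
      already bounds its norm near \<open>c\<close>.\<close>
    moreover have "((z - w) * s z)\<^sup>2 = (z - w) * (z - w')"
      by (subst sq[OF z(1), symmetric]) (simp add: power2_eq_square)
    then have "(norm ((z - w) * s z))\<^sup>2 = norm (z - w) * norm (z - w')"
      by (metis norm_mult norm_power)
    ultimately have "(norm ((z - w) * s z))\<^sup>2 \<le> (25/2)\<^sup>2" by (simp add: power2_eq_square)
    then have "norm ((z - w) * s z) \<le> 25/2" by (rule power2_le_imp_le) simp
    then have "norm (z - c - (z - w) * s z) \<le> 12 + 25/2"
      using z(2) norm_triangle_ineq4[of "z - c" "(z - w) * s z"] by linarith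
    moreover have "norm (h z) = 8 * norm (z - c - (z - w) * s z)"
      unfolding h_def norm_mult norm_divide norm_power norm_numeral d by (simp add: power2_eq_square)
    ultimately show "norm (h z) \<le> 200" by linarith
  next
    fix z assume z: "z \<in> V" "12 \<le> norm (z - c)"
    define u where "u = d / (z - c)"
    \<comment> \<open>\<open>\<sigma>\<close> turns out to be the principal root of
      \<open>1 - u^2\<close>. Its real part is nonnegative, so
      \<open>norm (1 + \<sigma>) \<ge> 1\<close>, and
      \<open>1 - \<sigma> = u^2 / (1 + \<sigma>)\<close> shows the cancellation in
      \<open>h\<close>.\<close>
    define \<sigma> where "\<sigma> = (1 + u) * s z"
    have zc: "z - c \<noteq> 0" using z(2) by auto
    have u0: "u \<noteq> 0" using d0 zc by (simp add: u_def)
    have "norm u \<le> 1 / 24"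
      using z(2) by (simp add: u_def norm_divide d divide_simps)
    then have Re: "0 < Re (1 + u)" "0 < Re (1 - u)"
      using Re_one_minus_pos[of u] Re_one_minus_pos[of "-u"] by auto
    have "\<sigma> = csqrt (1 + u) * (s z * csqrt (1 + u))"
      unfolding \<sigma>_def by (metis mult.assoc mult.commute power2_csqrt power2_eq_square)
    also have "\<dots> = csqrt ((1 + u) * (1 - u))"
      using far[OF z(1)] z(2) csqrt_mult_Re_pos[OF Re] by (simp add: u_def)
    finally have \<sigma>: "\<sigma> = csqrt ((1 + u) * (1 - u))" .
    then have \<sigma>2: "\<sigma>\<^sup>2 = 1 - u\<^sup>2" by (simp only: power2_csqrt) (simp add: power2_eq_square algebra_simps)
    have "Re \<sigma> \<ge> 0" using csqrt_principal[of "(1 + u) * (1 - u)"] \<sigma> by auto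
    then have n1: "norm (1 + \<sigma>) \<ge> 1" using complex_Re_le_cmod[of "1 + \<sigma>"] by simp
    then have s0: "1 + \<sigma> \<noteq> 0" by auto
    have u2: "u\<^sup>2 = (1 - \<sigma>) * (1 + \<sigma>)" using \<sigma>2 by (simp add: power2_eq_square algebra_simps)
    have deq: "d = u * (z - c)" using zc by (simp add: u_def)
    have zw: "z - w = (z - c) * (1 + u)" by (simp add: wc deq algebra_simps)
    have "z - c - (z - w) * s z = (z - c) * (1 - \<sigma>)"
      unfolding zw \<sigma>_def by (simp add: algebra_simps)
    then have "h z = 2 / (u * (z - c))\<^sup>2 * ((z - c) * (1 - \<sigma>))"
      by (simp only: h_def deq)
    also have "\<dots> - 1 / (z - c) = u\<^sup>2 / ((1 + \<sigma>)\<^sup>2 * (z - c))"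
    proof -
      define x where "x = z - c"
      have "x \<noteq> 0" using zc by (simp add: x_def)
      have "1 - \<sigma> \<noteq> 0" using u2 u0 by auto
      have "2 / (u * x)\<^sup>2 * (x * (1 - \<sigma>)) = 2 * (1 - \<sigma>) / (u\<^sup>2 * x)"
        using \<open>x \<noteq> 0\<close> u0 by (simp add: power2_eq_square)
      also have "\<dots> = 2 / ((1 + \<sigma>) * x)"
        unfolding u2 using \<open>x \<noteq> 0\<close> \<open>1 - \<sigma> \<noteq> 0\<close> s0
        by (subst frac_eq_eq) ((simp; fail) | (simp add: algebra_simps; fail))+
      also have "\<dots> - 1 / x = (1 - \<sigma>) / ((1 + \<sigma>) * x)"
        using \<open>x \<noteq> 0\<close> s0 by (simp add: divide_simps)
      also have "\<dots> = u\<^sup>2 / ((1 + \<sigma>)\<^sup>2 * x)"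
        unfolding u2 using \<open>x \<noteq> 0\<close> s0 by (simp add: power2_eq_square)
      finally show ?thesis by (simp add: x_def)
    qed
    finally have "norm (h z - 1 / (z - c)) = norm u ^ 2 / (norm (1 + \<sigma>) ^ 2 * norm (z - c))"
      by (simp add: norm_divide norm_mult norm_power)
    also have "\<dots> \<le> norm u ^ 2 / (1 * norm (z - c))"
      using n1 zc by (intro divide_left_mono mult_right_mono mult_pos_pos) (auto simp: one_le_power)
    also have "\<dots> = (1 / 4) / norm (z - c) ^ 3"
      using zc by (simp add: u_def norm_divide d power2_eq_square power3_eq_cube)
    also have "\<dots> \<le> 1 / norm (z - c) ^ 3"
      using zc by (intro divide_right_mono) auto
    finally show "norm (h z - 1 / (z - c)) \<le> 1 / norm (z - c) ^ 3" .
  qed (use V in auto)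
qed

section \<open>Localization to grid cells\<close>

abbreviation unit_rect :: "complex \<Rightarrow> real \<Rightarrow> complex" where
  "unit_rect q \<equiv> rectpath q (q + Complex 1 1)"

abbreviation unit_cell :: "complex \<Rightarrow> complex set" where
  "unit_cell q \<equiv> cbox q (q + Complex 1 1)"

text \<open>For smooth \<open>F\<close> this is, by the Cauchy-Pompeiu formula, the Cauchy transform
  of the d-bar derivative of \<open>F\<close> over the square; the boundary form needs no
  derivative. On the boundary of the square the value carries no meaning, and the estimates exclude
  it.\<close>

definition cell_part :: "(complex \<Rightarrow> complex) \<Rightarrow> complex \<Rightarrow> complex \<Rightarrow> complex" where
  "cell_part F q z = (if z \<in> box q (q + Complex 1 1) then F z else 0)
     - contour_integral (unit_rect q) (\<lambda>\<zeta>. F \<zeta> / (\<zeta> - z)) / (2 * pi * \<i>)"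

lemma unit_rect_image: "path_image (unit_rect q) = unit_cell q - box q (q + Complex 1 1)"
  by (intro path_image_rectpath_cbox_minus_box) auto

lemma unit_rect_eq:
  "unit_rect q = linepath q (q + 1) +++ linepath (q + 1) (q + 1 + \<i>)
     +++ linepath (q + 1 + \<i>) (q + \<i>) +++ linepath (q + \<i>) q"
proof -
  have eq: "Complex (Re (q + Complex 1 1)) (Im q) = q + 1"
      "Complex (Re q) (Im (q + Complex 1 1)) = q + \<i>"
    by (auto simp: complex_eq_iff)
  have eq': "q + Complex 1 1 = q + 1 + \<i>" by (auto simp: complex_eq_iff)
  show ?thesis
    unfolding rectpath_def Let_def eq unfolding eq' ..
qed

lemma unit_rect_segments:
  "path_image (unit_rect q) =
     closed_segment q (q + 1) \<union> closed_segment (q + 1) (q + 1 + \<i>) \<union>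
     closed_segment (q + \<i>) (q + 1 + \<i>) \<union> closed_segment q (q + \<i>)"
  unfolding unit_rect_eq by (simp add: path_image_join closed_segment_commute Un_assoc)

text \<open>All sides are oriented rightwards or upwards, so a side shared by adjacent squares
  yields literally the same term and sums over the grid telescope.\<close>

lemma unit_rect_integral:
  assumes g: "continuous_on (path_image (unit_rect q)) g"
  shows "g contour_integrable_on unit_rect q"
    and "contour_integral (unit_rect q) g =
      contour_integral (linepath q (q + 1)) g + contour_integral (linepath (q + 1) (q + 1 + \<i>)) g
      - contour_integral (linepath (q + \<i>) (q + \<i> + 1)) g - contour_integral (linepath q (q + \<i>)) g"
proof -
  have ci: "g contour_integrable_on linepath a b"
    if "closed_segment a b \<subseteq> path_image (unit_rect q)" for a b
    by (intro contour_integrable_continuous_linepath continuous_on_subset[OF g that])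
  have 1: "g contour_integrable_on linepath q (q + 1)"
      "g contour_integrable_on linepath (q + 1) (q + 1 + \<i>)"
      "g contour_integrable_on linepath (q + 1 + \<i>) (q + \<i>)"
      "g contour_integrable_on linepath (q + \<i>) q"
    by (intro ci; unfold unit_rect_segments closed_segment_commute[of "q + 1 + \<i>" "q + \<i>"]
          closed_segment_commute[of "q + \<i>" q]; blast)+
  show "g contour_integrable_on unit_rect q"
    unfolding unit_rect_eq using 1 by simp
  have "contour_integral (unit_rect q) g = contour_integral (linepath q (q + 1)) g
     + contour_integral (linepath (q + 1) (q + 1 + \<i>)) g
     + contour_integral (linepath (q + 1 + \<i>) (q + \<i>)) g + contour_integral (linepath (q + \<i>) q) g"
    unfolding unit_rect_eq using 1 by simp
  moreover have "contour_integral (linepath (q + 1 + \<i>) (q + \<i>)) g = - contour_integral (linepath (q + \<i>) (q + \<i> + 1)) g"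
    using contour_integral_reversepath[of "linepath (q + \<i>) (q + \<i> + 1)" g] by (simp add: add_ac)
  moreover have "contour_integral (linepath (q + \<i>) q) g = - contour_integral (linepath q (q + \<i>)) g"
    using contour_integral_reversepath[of "linepath q (q + \<i>)" g] by simp
  ultimately show "contour_integral (unit_rect q) g =
      contour_integral (linepath q (q + 1)) g + contour_integral (linepath (q + 1) (q + 1 + \<i>)) g
      - contour_integral (linepath (q + \<i>) (q + \<i> + 1)) g - contour_integral (linepath q (q + \<i>)) g"
    by simp
qed

text \<open>The perimeter 4 is less than \<open>2 * pi\<close>, so no constant is lost.\<close>

lemma unit_rect_bound:
  assumes g: "continuous_on (path_image (unit_rect q)) g" and "B \<ge> 0"
    and B: "\<And>\<zeta>. \<zeta> \<in> path_image (unit_rect q) \<Longrightarrow> norm (g \<zeta>) \<le> B"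
  shows "norm (contour_integral (unit_rect q) g / (2 * pi * \<i>)) \<le> B"
proof -
  have 1: "norm (contour_integral (linepath a b) g) \<le> B * norm (b - a)"
    if "closed_segment a b \<subseteq> path_image (unit_rect q)" for a b
    using that B \<open>B \<ge> 0\<close>
    by (intro contour_integral_bound_linepath contour_integrable_continuous_linepath
          continuous_on_subset[OF g that]) auto
  have "norm (contour_integral (linepath q (q + 1)) g) \<le> B"
      "norm (contour_integral (linepath (q + 1) (q + 1 + \<i>)) g) \<le> B"
      "norm (contour_integral (linepath (q + \<i>) (q + \<i> + 1)) g) \<le> B"
      "norm (contour_integral (linepath q (q + \<i>)) g) \<le> B"
    using 1[of q "q + 1"] 1[of "q + 1" "q + 1 + \<i>"] 1[of "q + \<i>" "q + \<i> + 1"] 1[of q "q + \<i>"]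
    by (auto simp: unit_rect_segments add_ac)
  then have "norm (contour_integral (unit_rect q) g) \<le> B + B + B + B"
    unfolding unit_rect_integral(2)[OF g] by norm
  also have "\<dots> \<le> B * (2 * pi)" using mult_left_mono[OF less_imp_le[OF pi_gt3] \<open>B \<ge> 0\<close>] \<open>B \<ge> 0\<close> by simp
  finally show ?thesis by (simp add: norm_divide norm_mult divide_le_eq mult_ac)
qed

lemma unit_rect_winding:
  assumes "z \<notin> path_image (unit_rect q)"
  shows "contour_integral (unit_rect q) (\<lambda>\<zeta>. v / (\<zeta> - z)) / (2 * pi * \<i>) =
     (if z \<in> box q (q + Complex 1 1) then v else 0)"
proof -
  have "contour_integral (unit_rect q) (\<lambda>\<zeta>. v / (\<zeta> - z)) = v * (2 * pi * \<i> * winding_number (unit_rect q) z)"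
    using has_contour_integral_lmul[OF has_contour_integral_winding_number[OF valid_path_rectpath assms], of v]
    by (simp add: contour_integral_unique)
  moreover have "winding_number (unit_rect q) z = (if z \<in> box q (q + Complex 1 1) then 1 else 0)"
    using assms by (auto simp: unit_rect_image winding_number_rectpath winding_number_rectpath_outside)
  moreover have "v * (2 * pi * \<i> * w) / (2 * pi * \<i>) = v * w" for w
    by (rule nonzero_divide_eq_eq[THEN iffD2]) (auto simp: mult_ac)
  ultimately show ?thesis by simp
qed

text \<open>Subtracting \<open>v\<close> from \<open>F\<close> changes the normalized Cauchy
  integral by \<open>v\<close> times the winding number. Inside the square this absorbs the summand
  \<open>F z\<close>; outside, the winding number is 0 and \<open>v\<close> is arbitrary.\<close>

lemma cell_part_shift:
  assumes F: "continuous_on (path_image (unit_rect q)) F" and z: "z \<notin> path_image (unit_rect q)"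
    and v: "z \<in> box q (q + Complex 1 1) \<Longrightarrow> v = F z"
  shows "cell_part F q z = - (contour_integral (unit_rect q) (\<lambda>\<zeta>. (F \<zeta> - v) / (\<zeta> - z)) / (2 * pi * \<i>))"
proof -
  have "contour_integral (unit_rect q) (\<lambda>\<zeta>. F \<zeta> / (\<zeta> - z) - v / (\<zeta> - z)) =
      contour_integral (unit_rect q) (\<lambda>\<zeta>. F \<zeta> / (\<zeta> - z)) - contour_integral (unit_rect q) (\<lambda>\<zeta>. v / (\<zeta> - z))"
    using F z by (intro contour_integral_diff unit_rect_integral continuous_intros) auto
  then have "contour_integral (unit_rect q) (\<lambda>\<zeta>. (F \<zeta> - v) / (\<zeta> - z)) / (2 * pi * \<i>) =
     contour_integral (unit_rect q) (\<lambda>\<zeta>. F \<zeta> / (\<zeta> - z)) / (2 * pi * \<i>)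
     - contour_integral (unit_rect q) (\<lambda>\<zeta>. v / (\<zeta> - z)) / (2 * pi * \<i>)"
    by (simp add: diff_divide_distrib)
  then show ?thesis
    unfolding cell_part_def unit_rect_winding[OF z] using v by simp
qed

text \<open>Shift by \<open>F p\<close> with \<open>p\<close> the point of the square closest to
  \<open>z\<close>. Projection onto a convex set does not increase distances, so
  \<open>(F \<zeta> - F p) / (\<zeta> - z)\<close> has norm at most \<open>M\<close>.\<close>

lemma cell_part_bound:
  assumes F: "\<And>x y. norm (F x - F y) \<le> M * norm (x - y)"
    and z: "z \<notin> path_image (unit_rect q)"
  shows "norm (cell_part F q z) \<le> M"
proof -
  have M: "M \<ge> 0" using order_trans[OF norm_ge_zero F[of 1 0]] by simp
  have "M-lipschitz_on UNIV F" using F M by (auto simp: lipschitz_on_def dist_norm)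
  then have contF: "continuous_on A F" for A
    using lipschitz_on_continuous_on continuous_on_subset by blast
  define p where "p = closest_point (unit_cell q) z"
  have ne: "q \<in> unit_cell q" by (auto simp: in_cbox_complex_iff)
  have p: "norm (\<zeta> - p) \<le> norm (\<zeta> - z)" if "\<zeta> \<in> unit_cell q" for \<zeta>
    using closest_point_lipschitz[of "unit_cell q" \<zeta> z] closest_point_self[OF that] ne
    by (auto simp: p_def dist_norm)
  have "p = z" if "z \<in> box q (q + Complex 1 1)"
    using that box_subset_cbox unfolding p_def by (intro closest_point_self) blast
  then have eq: "cell_part F q z = - (contour_integral (unit_rect q) (\<lambda>\<zeta>. (F \<zeta> - F p) / (\<zeta> - z)) / (2 * pi * \<i>))"
    using z by (intro cell_part_shift contF) auto
  have "norm (contour_integral (unit_rect q) (\<lambda>\<zeta>. (F \<zeta> - F p) / (\<zeta> - z)) / (2 * pi * \<i>)) \<le> M"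
  proof (rule unit_rect_bound[OF _ M])
    show "continuous_on (path_image (unit_rect q)) (\<lambda>\<zeta>. (F \<zeta> - F p) / (\<zeta> - z))"
      using z by (intro continuous_intros contF) auto
    fix \<zeta> assume \<zeta>: "\<zeta> \<in> path_image (unit_rect q)"
    then have "\<zeta> \<noteq> z" using z by auto
    have "norm (F \<zeta> - F p) \<le> M * norm (\<zeta> - p)" by (rule F)
    also have "\<dots> \<le> M * norm (\<zeta> - z)"
      using \<zeta> M by (intro mult_left_mono p) (auto simp: unit_rect_image)
    finally show "norm ((F \<zeta> - F p) / (\<zeta> - z)) \<le> M"
      using \<open>\<zeta> \<noteq> z\<close> by (simp add: norm_divide divide_le_eq)
  qed
  then show ?thesis unfolding eq norm_minus_cancel .
qed

lemma unit_cell_diameter: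
  assumes "x \<in> unit_cell q" "y \<in> unit_cell q"
  shows "norm (x - y) \<le> 2"
  using assms cmod_le[of "x - y"] by (auto simp: in_cbox_complex_iff)

text \<open>Laurent expansion at infinity: \<open>1 / (\<zeta> - z)\<close> is expanded in
  \<open>1 / (z - c)\<close> to second order with exact remainder. The constants come from
  \<open>norm (G \<zeta>) \<le> 2 * M\<close>, \<open>norm (\<zeta> - c) \<le> 6\<close> and
  \<open>norm (z - \<zeta>) \<ge> norm (z - c) / 2\<close>.\<close>

lemma cell_part_expansion:
  assumes F: "\<And>x y. norm (F x - F y) \<le> M * norm (x - y)"
    and c: "\<And>\<zeta>. \<zeta> \<in> unit_cell q \<Longrightarrow> norm (\<zeta> - c) \<le> 6"
  obtains a1 a2 where "norm a1 \<le> 2 * M" "norm a2 \<le> 12 * M"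
    "\<And>z. 12 \<le> norm (z - c) \<Longrightarrow>
       norm (cell_part F q z - (a1 / (z - c) + a2 / (z - c)\<^sup>2)) \<le> 144 * M / norm (z - c) ^ 3"
proof -
  have M: "M \<ge> 0" using order_trans[OF norm_ge_zero F[of 1 0]] by simp
  have "M-lipschitz_on UNIV F" using F M by (auto simp: lipschitz_on_def dist_norm)
  then have contF: "continuous_on A F" for A
    using lipschitz_on_continuous_on continuous_on_subset by blast
  define G where "G = (\<lambda>\<zeta>. F \<zeta> - F q)"
  have contG: "continuous_on A G" for A unfolding G_def by (intro continuous_intros contF)
  have G: "norm (G \<zeta>) \<le> 2 * M" if "\<zeta> \<in> unit_cell q" for \<zeta>
  proof -
    have "norm (G \<zeta>) \<le> M * norm (\<zeta> - q)" unfolding G_def by (rule F)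
    also have "\<dots> \<le> M * 2"
      using that M by (intro mult_left_mono unit_cell_diameter) (auto simp: in_cbox_complex_iff)
    finally show ?thesis by simp
  qed
  have sub: "\<zeta> \<in> unit_cell q" if "\<zeta> \<in> path_image (unit_rect q)" for \<zeta>
    using that by (simp add: unit_rect_image)
  define I where "I = (\<lambda>g. contour_integral (unit_rect q) g / (2 * pi * \<i>))"
  show thesis
  proof (rule that[of "I G" "I (\<lambda>\<zeta>. G \<zeta> * (\<zeta> - c))"])
    show "norm (I G) \<le> 2 * M"
      unfolding I_def using M G sub by (intro unit_rect_bound contG) auto
    have "norm (G \<zeta> * (\<zeta> - c)) \<le> 2 * M * 6" if "\<zeta> \<in> unit_cell q" for \<zeta>
      unfolding norm_mult using G[OF that] c[OF that] M by (intro mult_mono) auto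
    then show "norm (I (\<lambda>\<zeta>. G \<zeta> * (\<zeta> - c))) \<le> 12 * M"
      unfolding I_def using M sub by (intro unit_rect_bound continuous_intros contG) auto
    fix z assume z: "12 \<le> norm (z - c)"
    then have zc: "z \<noteq> c" by auto
    have far: "norm (z - c) / 2 \<le> norm (z - \<zeta>)" if "\<zeta> \<in> unit_cell q" for \<zeta>
      using c[OF that] z norm_triangle_ineq[of "z - \<zeta>" "\<zeta> - c"] by simp
    have z': "z \<notin> unit_cell q" using far[of z] z by auto
    have ne: "z \<noteq> \<zeta>" if "\<zeta> \<in> path_image (unit_rect q)" for \<zeta> using that sub z' by auto
    define R where "R = (\<lambda>\<zeta>. G \<zeta> * (\<zeta> - c)\<^sup>2 / ((z - c)\<^sup>2 * (z - \<zeta>)))"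
    have contR: "continuous_on (path_image (unit_rect q)) R"
      unfolding R_def using ne zc by (intro continuous_intros contG) auto
    have "cell_part F q z = - I (\<lambda>\<zeta>. G \<zeta> / (\<zeta> - z))"
      unfolding I_def G_def using z' sub box_subset_cbox by (intro cell_part_shift contF) blast+
    also have "contour_integral (unit_rect q) (\<lambda>\<zeta>. G \<zeta> / (\<zeta> - z)) = contour_integral (unit_rect q)
        (\<lambda>\<zeta>. - (G \<zeta> / (z - c) + G \<zeta> * (\<zeta> - c) / (z - c)\<^sup>2 + R \<zeta>))"
    proof (rule contour_integral_eq)
      fix \<zeta> assume "\<zeta> \<in> path_image (unit_rect q)"
      then have "z - \<zeta> \<noteq> 0" using ne by auto
      moreover have "1 / (\<zeta> - z) = - (1 / (z - c) + (\<zeta> - c) / (z - c)\<^sup>2 + (\<zeta> - c)\<^sup>2 / ((z - c)\<^sup>2 * (z - \<zeta>)))"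
      proof -
        define x y where "x = z - c" and "y = z - \<zeta>"
        have "x \<noteq> 0" "y \<noteq> 0" using zc \<open>z - \<zeta> \<noteq> 0\<close> by (auto simp: x_def y_def)
        moreover have "z - c = x" "z - \<zeta> = y" "\<zeta> - z = - y" "\<zeta> - c = x - y"
          by (auto simp: x_def y_def)
        ultimately show ?thesis
          by (simp only:) (simp add: field_simps power2_eq_square)
      qed
      then have "G \<zeta> * (1 / (\<zeta> - z)) = G \<zeta> * - (1 / (z - c) + (\<zeta> - c) / (z - c)\<^sup>2 + (\<zeta> - c)\<^sup>2 / ((z - c)\<^sup>2 * (z - \<zeta>)))"
        by simp
      then show "G \<zeta> / (\<zeta> - z) = - (G \<zeta> / (z - c) + G \<zeta> * (\<zeta> - c) / (z - c)\<^sup>2 + R \<zeta>)"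
        by (simp add: R_def algebra_simps)
    qed
    then have "I (\<lambda>\<zeta>. G \<zeta> / (\<zeta> - z)) = I (\<lambda>\<zeta>. - (G \<zeta> / (z - c) + G \<zeta> * (\<zeta> - c) / (z - c)\<^sup>2 + R \<zeta>))"
      by (simp add: I_def)
    also have "\<dots> = - (I G / (z - c) + I (\<lambda>\<zeta>. G \<zeta> * (\<zeta> - c)) / (z - c)\<^sup>2 + I R)"
    proof -
      have i: "(G has_contour_integral contour_integral (unit_rect q) G) (unit_rect q)"
        "((\<lambda>\<zeta>. G \<zeta> * (\<zeta> - c)) has_contour_integral
            contour_integral (unit_rect q) (\<lambda>\<zeta>. G \<zeta> * (\<zeta> - c))) (unit_rect q)"
        "(R has_contour_integral contour_integral (unit_rect q) R) (unit_rect q)"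
        by (intro has_contour_integral_integral unit_rect_integral continuous_intros contG contR)+
      show ?thesis
        unfolding I_def
          contour_integral_unique[OF has_contour_integral_neg[OF has_contour_integral_add[OF
            has_contour_integral_add[OF has_contour_integral_div[OF i(1)]
              has_contour_integral_div[OF i(2)]] i(3)]]]
        by (simp add: add_divide_distrib diff_divide_distrib mult_ac)
    qed
    finally have eq: "cell_part F q z - (I G / (z - c) + I (\<lambda>\<zeta>. G \<zeta> * (\<zeta> - c)) / (z - c)\<^sup>2) = I R"
      by simp
    have "norm (I R) \<le> 144 * M / norm (z - c) ^ 3"
      unfolding I_def
    proof (rule unit_rect_bound[OF contR])
      show "0 \<le> 144 * M / cmod (z - c) ^ 3" using M by simp
      fix \<zeta> assume "\<zeta> \<in> path_image (unit_rect q)"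
      then have \<zeta>: "\<zeta> \<in> unit_cell q" by (rule sub)
      have "norm (R \<zeta>) = norm (G \<zeta>) * norm (\<zeta> - c) ^ 2 / (norm (z - c) ^ 2 * norm (z - \<zeta>))"
        by (simp add: R_def norm_mult norm_divide norm_power)
      also have "\<dots> \<le> (2 * M * 6 ^ 2) / (norm (z - c) ^ 2 * (norm (z - c) / 2))"
        using G[OF \<zeta>] c[OF \<zeta>] far[OF \<zeta>] M zc
        by (intro frac_le mult_mono power_mono mult_pos_pos) auto
      also have "\<dots> = 144 * M / norm (z - c) ^ 3" by (simp add: power2_eq_square power3_eq_cube)
      finally show "norm (R \<zeta>) \<le> 144 * M / norm (z - c) ^ 3" .
    qed
    then show "norm (cell_part F q z - (I G / (z - c) + I (\<lambda>\<zeta>. G \<zeta> * (\<zeta> - c)) / (z - c)\<^sup>2))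
        \<le> 144 * M / norm (z - c) ^ 3"
      by (simp add: eq)
  qed
qed

lemma cell_part_holomorphic:
  assumes "F holomorphic_on unit_cell q" "z \<notin> path_image (unit_rect q)"
  shows "cell_part F q z = 0"
proof (cases "z \<in> box q (q + Complex 1 1)")
  case True
  have "((\<lambda>w. F w / (w - z)) has_contour_integral (2 * pi * \<i> * winding_number (unit_rect q) z * F z)) (unit_rect q)"
    using assms True
    by (intro Cauchy_integral_formula_convex_simple[of "unit_cell q"])
       (auto simp: unit_rect_image interior_cbox)
  then show ?thesis
    using True by (simp add: cell_part_def contour_integral_unique winding_number_rectpath)
next
  case False
  then have z: "z \<notin> unit_cell q" using assms(2) by (auto simp: unit_rect_image)
  have "((\<lambda>w. F w / (w - z)) has_contour_integral 0) (unit_rect q)"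
    using assms z
    by (intro Cauchy_theorem_convex_simple[of _ "unit_cell q"] holomorphic_intros)
       (auto simp: unit_rect_image)
  then show ?thesis
    using False by (simp add: cell_part_def contour_integral_unique)
qed

text \<open>Cubic decay of the error is what makes the errors summable over the planar grid. Where
  \<open>F\<close> is holomorphic the cell part vanishes; otherwise \<open>capacity_function\<close>
  applies at a nearby point of the complement. The open \<open>V\<close> around \<open>L\<close>
  later allows a bound known off the grid lines to be extended to \<open>L\<close>.\<close>

lemma cell_part_approx:
  assumes L: "compact L" "connected (- L)"
    and F: "\<And>x y. norm (F x - F y) \<le> M * norm (x - y)"
    and near: "F holomorphic_on unit_cell q \<or> (\<exists>p\<in>unit_cell q. \<exists>w. w \<notin> L \<and> norm (p - w) \<le> 3)"
  shows "\<exists>V \<Psi>. open V \<and> L \<subseteq> V \<and> continuous_on V \<Psi> \<and> poly_approx L \<Psi> \<and>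
    (\<forall>z\<in>V. z \<notin> path_image (unit_rect q) \<longrightarrow>
       norm (cell_part F q z - \<Psi> z) \<le> 10 ^ 10 * M * (1 / (1 + norm (z - q)) ^ 3))"
proof -
  have M: "M \<ge> 0" using order_trans[OF norm_ge_zero F[of 1 0]] by simp
  show ?thesis
    using near
  proof
    assume hol: "F holomorphic_on unit_cell q"
    have "norm (cell_part F q z - 0) \<le> 10 ^ 10 * M * (1 / (1 + norm (z - q)) ^ 3)"
      if "z \<notin> path_image (unit_rect q)" for z
      using cell_part_holomorphic[OF hol that] M by simp
    then show ?thesis
      by (intro exI[of _ UNIV] exI[of _ "\<lambda>z. 0"]) (auto intro: poly_approx_const)
  next
    assume "\<exists>p\<in>unit_cell q. \<exists>w. w \<notin> L \<and> norm (p - w) \<le> 3"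
    then obtain p w where p: "p \<in> unit_cell q" and w: "w \<notin> L" and pw: "norm (p - w) \<le> 3"
      by blast
    obtain c V h where c: "norm (c - w) \<le> 1" and V: "open V" "L \<subseteq> V"
      and h: "continuous_on V h" "poly_approx L h"
      and hnear: "\<And>z. z \<in> V \<Longrightarrow> norm (z - c) \<le> 12 \<Longrightarrow> norm (h z) \<le> 200"
      and hfar: "\<And>z. z \<in> V \<Longrightarrow> 12 \<le> norm (z - c) \<Longrightarrow> norm (h z - 1 / (z - c)) \<le> 1 / norm (z - c) ^ 3"
      by (rule capacity_function[OF L w]) (rule that)
    have c6: "norm (\<zeta> - c) \<le> 6" if "\<zeta> \<in> unit_cell q" for \<zeta>
    proof -
      have "norm (\<zeta> - c) \<le> norm (\<zeta> - p) + norm (p - w) + norm (w - c)" by norm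
      then show ?thesis using unit_cell_diameter[OF that p] pw c by (simp add: norm_minus_commute)
    qed
    have "q \<in> unit_cell q" by (auto simp: in_cbox_complex_iff)
    then have cq: "norm (q - c) \<le> 6" by (rule c6)
    obtain a1 a2 where a: "norm a1 \<le> 2 * M" "norm a2 \<le> 12 * M"
      and far: "\<And>z. 12 \<le> norm (z - c) \<Longrightarrow>
       norm (cell_part F q z - (a1 / (z - c) + a2 / (z - c)\<^sup>2)) \<le> 144 * M / norm (z - c) ^ 3"
      using cell_part_expansion[OF F c6] by blast
    \<comment> \<open>\<open>h\<close> agrees with \<open>1 / (z - c)\<close> and its square with
      \<open>1 / (z - c)^2\<close> up to cubic errors, so \<open>\<Psi>\<close> matches the first
      two Laurent coefficients of the cell part.\<close>
    define \<Psi> where "\<Psi> = (\<lambda>z. a1 * h z + a2 * h z ^ 2)"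
    have bound: "norm (cell_part F q z - \<Psi> z) \<le> 10 ^ 10 * M * (1 / (1 + norm (z - q)) ^ 3)"
      if z: "z \<in> V" "z \<notin> path_image (unit_rect q)" for z
    proof (cases "norm (z - c) \<le> 12")
      case True
      have h2: "norm (h z) \<le> 200" "norm (h z) ^ 2 \<le> 200 ^ 2"
        using hnear[OF z(1) True] power_mono[OF hnear[OF z(1) True] norm_ge_zero, of 2] by auto
      have "norm (\<Psi> z) \<le> norm a1 * norm (h z) + norm a2 * norm (h z) ^ 2"
        unfolding \<Psi>_def by (metis norm_mult norm_power norm_triangle_ineq)
      also have "\<dots> \<le> (2 * M) * 200 + (12 * M) * 200 ^ 2"
        using a h2 M by (intro add_mono mult_mono) auto
      finally have "norm (cell_part F q z - \<Psi> z) \<le> M + (2 * M * 200 + 12 * M * 200 ^ 2)"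
        using cell_part_bound[OF F z(2)] norm_triangle_ineq4[of "cell_part F q z" "\<Psi> z"] by linarith
      also have "\<dots> = 480401 * M" by simp
      \<comment> \<open>Here \<open>norm (z - q) \<le> 12 + 6\<close>, whence 19; the generous
        \<open>10 ^ 10\<close> covers both the near and the far range.\<close>
      also have "\<dots> \<le> 10 ^ 10 * M * (1 / 19 ^ 3)" using M by simp
      also have "\<dots> \<le> 10 ^ 10 * M * (1 / (1 + norm (z - q)) ^ 3)"
      proof -
        have "norm (z - q) \<le> 18" using True cq norm_triangle_ineq4[of "z - c" "q - c"] by simp
        then have "(1 + norm (z - q)) ^ 3 \<le> 19 ^ 3" by (intro power_mono) auto
        then show ?thesis using M
          by (intro mult_left_mono divide_left_mono mult_pos_pos zero_less_power add_pos_nonneg) auto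
      qed
      finally show ?thesis .
    next
      case False
      define x where "x = z - c"
      define r where "r = norm x"
      have r: "r \<ge> 12" using False by (simp add: r_def x_def)
      have r3: "r ^ 3 \<ge> 1" using r by (intro one_le_power) auto
      have h1: "norm (h z - 1 / x) \<le> 1 / r ^ 3"
        using hfar[OF z(1)] r by (simp add: x_def r_def)
      have "norm (h z + 1 / x) \<le> norm (h z - 1 / x) + 2 * norm (1 / x)"
      proof -
        have "h z + 1 / x = (h z - 1 / x) + 2 * (1 / x)" by simp
        then show ?thesis by (metis norm_mult norm_numeral norm_triangle_ineq)
      qed
      also have "\<dots> \<le> 1 / 12 ^ 3 + 2 * (1 / 12)"
      proof (intro add_mono mult_left_mono)
        have "1 / r ^ 3 \<le> 1 / 12 ^ 3" using r by (intro divide_left_mono power_mono) auto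
        then show "norm (h z - 1 / x) \<le> 1 / 12 ^ 3" using h1 by linarith
        show "norm (1 / x) \<le> 1 / 12" using r by (simp add: norm_divide r_def divide_simps)
      qed auto
      finally have h3: "norm (h z + 1 / x) \<le> 1" by simp
      have "norm (h z ^ 2 - 1 / x ^ 2) = norm (h z - 1 / x) * norm (h z + 1 / x)"
        by (simp add: power2_eq_square algebra_simps flip: norm_mult)
      also have "\<dots> \<le> 1 / r ^ 3 * 1"
        using h1 h3 r by (intro mult_mono) auto
      finally have h4: "norm (h z ^ 2 - 1 / x ^ 2) \<le> 1 / r ^ 3" by simp
      have "cell_part F q z - \<Psi> z = (cell_part F q z - (a1 / x + a2 / x\<^sup>2))
          - (a1 * (h z - 1 / x) + a2 * (h z ^ 2 - 1 / x ^ 2))"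
        by (simp add: \<Psi>_def algebra_simps)
      also have "norm \<dots> \<le> norm (cell_part F q z - (a1 / x + a2 / x\<^sup>2))
          + (norm a1 * norm (h z - 1 / x) + norm a2 * norm (h z ^ 2 - 1 / x ^ 2))"
        by (intro order_trans[OF norm_triangle_ineq4] add_left_mono order_trans[OF norm_triangle_ineq])
           (simp add: norm_mult)
      also have "\<dots> \<le> 144 * M / r ^ 3 + (2 * M * (1 / r ^ 3) + 12 * M * (1 / r ^ 3))"
        using far[of z] r a h1 h4 M by (intro add_mono mult_mono) (auto simp: x_def r_def)
      \<comment> \<open>The factor is \<open>(144 + 2 + 12) * 2^3\<close>; the 2 makes room for
        \<open>1 + norm (z - q) \<le> r + 7 \<le> 2 * r\<close>.\<close>
      also have "\<dots> = 1264 * M * (1 / (2 * r) ^ 3)" by (simp add: power_mult_distrib field_simps)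
      also have "\<dots> \<le> 10 ^ 10 * M * (1 / (1 + norm (z - q)) ^ 3)"
      proof (intro mult_mono divide_left_mono power_mono mult_pos_pos zero_less_power)
        have "norm (z - q) \<le> r + 6"
          using cq norm_triangle_ineq4[of "z - c" "q - c"] by (simp add: r_def x_def)
        then show "1 + norm (z - q) \<le> 2 * r" using r by simp
      qed (use M r in \<open>auto intro: add_pos_nonneg\<close>)
      finally show ?thesis .
    qed
    have "continuous_on V \<Psi>" "poly_approx L \<Psi>"
      unfolding \<Psi>_def using h L(1)
      by (auto intro!: continuous_intros poly_approx_add poly_approx_cmult poly_approx_power)
    with V bound show ?thesis by blast
  qed
qed

section \<open>Summation over the grid\<close>

definition grid_corner :: "nat \<Rightarrow> nat \<Rightarrow> nat \<Rightarrow> complex" where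
  "grid_corner N i j = Complex (real i - real N) (real j - real N)"

text \<open>The boundary integrals cancel along shared sides and vanish on the outer sides, where
  \<open>F\<close> is 0. What remains is \<open>F z\<close>, from the one square whose interior
  contains \<open>z\<close>.\<close>

lemma grid_sum:
  assumes F: "continuous_on UNIV F"
    and supp: "\<And>z. real N \<le> \<bar>Re z\<bar> \<or> real N \<le> \<bar>Im z\<bar> \<Longrightarrow> F z = 0"
    and z: "\<And>i j. i < 2 * N \<Longrightarrow> j < 2 * N \<Longrightarrow> z \<notin> path_image (unit_rect (grid_corner N i j))"
      "\<bar>Re z\<bar> < N" "\<bar>Im z\<bar> < N"
  shows "(\<Sum>i<2*N. \<Sum>j<2*N. cell_part F (grid_corner N i j) z) = F z"
proof -
  define g where "g = (\<lambda>\<zeta>. F \<zeta> / (\<zeta> - z))"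
  define H where "H = (\<lambda>i j. contour_integral (linepath (grid_corner N i j) (grid_corner N i j + 1)) g)"
  define V where "V = (\<lambda>i j. contour_integral (linepath (grid_corner N i j) (grid_corner N i j + \<i>)) g)"
  have Suc: "grid_corner N (Suc i) j = grid_corner N i j + 1" "grid_corner N i (Suc j) = grid_corner N i j + \<i>" for i j
    by (auto simp: grid_corner_def complex_eq_iff)
  have cell: "contour_integral (unit_rect (grid_corner N i j)) g = (H i j - H i (Suc j)) - (V i j - V (Suc i) j)"
    if "i < 2 * N" "j < 2 * N" for i j
  proof -
    have "continuous_on (path_image (unit_rect (grid_corner N i j))) g"
      unfolding g_def using z(1)[OF that] continuous_on_subset[OF F]
      by (intro continuous_intros) auto
    from unit_rect_integral(2)[OF this] show ?thesis
      by (simp add: H_def V_def Suc)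
  qed
  have zero: "contour_integral (linepath a b) g = 0"
    if "\<And>\<zeta>. \<zeta> \<in> closed_segment a b \<Longrightarrow> F \<zeta> = 0" for a b
  proof -
    have "contour_integral (linepath a b) g = contour_integral (linepath a b) (\<lambda>\<zeta>. 0)"
      using that by (intro contour_integral_eq) (simp add: g_def)
    then show ?thesis by simp
  qed
  have H0: "H i 0 = 0" "H i (2 * N) = 0" for i
    unfolding H_def by (intro zero supp; auto simp: closed_segment_same_Im grid_corner_def)+
  have V0: "V 0 j = 0" "V (2 * N) j = 0" for j
    unfolding V_def by (intro zero supp; auto simp: closed_segment_same_Re grid_corner_def)+
  have "(\<Sum>i<2*N. \<Sum>j<2*N. contour_integral (unit_rect (grid_corner N i j)) g)
      = (\<Sum>i<2*N. \<Sum>j<2*N. H i j - H i (Suc j)) - (\<Sum>i<2*N. \<Sum>j<2*N. V i j - V (Suc i) j)"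
    by (simp add: cell sum_subtractf)
  also have "(\<Sum>i<2*N. \<Sum>j<2*N. V i j - V (Suc i) j) = (\<Sum>j<2*N. \<Sum>i<2*N. V i j - V (Suc i) j)"
    by (rule sum.swap)
  also have "\<dots> = 0"
    using sum_lessThan_telescope'[of "\<lambda>i. V i _" "2 * N"] V0 by simp
  also have "(\<Sum>i<2*N. \<Sum>j<2*N. H i j - H i (Suc j)) = 0"
    unfolding sum_lessThan_telescope' using H0 by simp
  finally have int0: "(\<Sum>i<2*N. \<Sum>j<2*N. contour_integral (unit_rect (grid_corner N i j)) g) = 0"
    by simp
  define m n where "m = nat \<lfloor>Re z + N\<rfloor>" and "n = nat \<lfloor>Im z + N\<rfloor>"
  have mn: "m < 2 * N" "n < 2 * N" "m \<le> Re z + N" "Re z + N < m + 1" "n \<le> Im z + N" "Im z + N < n + 1"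
    using z(2,3) unfolding m_def n_def by linarith+
  have box: "z \<in> box (grid_corner N i j) (grid_corner N i j + Complex 1 1) \<longleftrightarrow> i = m \<and> j = n"
    if "i < 2 * N" "j < 2 * N" for i j
  proof
    assume "z \<in> box (grid_corner N i j) (grid_corner N i j + Complex 1 1)"
    then have "real i < Re z + N" "Re z + N < i + 1" "real j < Im z + N" "Im z + N < j + 1"
      by (auto simp: in_box_complex_iff grid_corner_def)
    then show "i = m \<and> j = n" using mn by linarith
  next
    assume "i = m \<and> j = n"
    then have "z \<in> unit_cell (grid_corner N i j)"
      using mn by (auto simp: in_cbox_complex_iff grid_corner_def)
    then show "z \<in> box (grid_corner N i j) (grid_corner N i j + Complex 1 1)"
      using z(1)[OF that] by (auto simp: unit_rect_image)
  qed
  have "(\<Sum>i<2*N. \<Sum>j<2*N. cell_part F (grid_corner N i j) z)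
      = (\<Sum>i<2*N. \<Sum>j<2*N. (if i = m \<and> j = n then F z else 0)
          - contour_integral (unit_rect (grid_corner N i j)) g / (2 * pi * \<i>))"
    by (intro sum.cong refl) (simp add: cell_part_def box g_def)
  also have "\<dots> = (\<Sum>i<2*N. \<Sum>j<2*N. (if i = m \<and> j = n then F z else 0))
      - (\<Sum>i<2*N. \<Sum>j<2*N. contour_integral (unit_rect (grid_corner N i j)) g) / (2 * pi * \<i>)"
    by (simp add: sum_subtractf sum_divide_distrib)
  also have "(\<Sum>i<2*N. \<Sum>j<2*N. (if i = m \<and> j = n then F z else 0)) = (\<Sum>i<2*N. if i = m then F z else 0)"
    by (intro sum.cong refl) (use mn in auto)
  also have "\<dots> = F z" using mn by simp
  finally show ?thesis by (simp add: int0)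
qed

text \<open>Each distance from \<open>k\<close> is attained at most twice, once on either
  side.\<close>

lemma sum_int_dist_le:
  fixes g :: "nat \<Rightarrow> real"
  assumes g: "summable g" "\<And>n. 0 \<le> g n" and "finite A"
  shows "(\<Sum>i\<in>A. g (nat \<bar>i - k\<bar>)) \<le> 2 * suminf g"
proof -
  have half: "(\<Sum>i\<in>B. g (nat \<bar>i - k\<bar>)) \<le> suminf g"
    if "finite B" "inj_on (\<lambda>i. nat \<bar>i - k\<bar>) B" for B
    using sum.reindex[OF that(2), of g] sum_le_suminf[OF g(1), of "(\<lambda>i. nat \<bar>i - k\<bar>) ` B"] g(2) that(1)
    by (simp add: o_def)
  have "(\<Sum>i\<in>A. g (nat \<bar>i - k\<bar>)) = (\<Sum>i\<in>A \<inter> {k..}. g (nat \<bar>i - k\<bar>)) + (\<Sum>i\<in>A - {k..}. g (nat \<bar>i - k\<bar>))"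
    by (rule sum.Int_Diff[OF \<open>finite A\<close>])
  also have "\<dots> \<le> suminf g + suminf g"
    using \<open>finite A\<close> by (intro add_mono half) (auto simp: inj_on_def)
  finally show ?thesis by simp
qed

text \<open>
  \<open>(1 + max s t) ^ 3 \<ge> (1 + s) powr (3/2) * (1 + t) powr (3/2)\<close> reduces the double sum to a product of
  two convergent simple ones.
\<close>

lemma lattice_sum_bound:
  "\<exists>S\<ge>0. \<forall>N z. (\<Sum>i<2*N. \<Sum>j<2*N. 1 / (1 + norm (z - grid_corner N i j)) ^ 3) \<le> S"
proof -
  \<comment> \<open>Since \<open>0 powr (-3/2) = 0\<close>, the value at \<open>n = 0\<close> has to
    be supplied separately.\<close>
  define g :: "nat \<Rightarrow> real" where "g = (\<lambda>n. real n powr (-3/2) + (if n = 0 then 1 else 0))"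
  have g0: "0 \<le> g n" for n by (simp add: g_def)
  have gs: "summable g"
    unfolding g_def
    by (intro summable_add) (auto simp: summable_real_powr_iff intro: summable_finite[of "{0}"])
  define \<phi> :: "real \<Rightarrow> real" where "\<phi> = (\<lambda>t. (1 + \<bar>t\<bar>) powr (-3/2))"
  have \<phi>: "\<phi> (x - real i + N) \<le> g (nat \<bar>int i - \<lfloor>x + N\<rfloor>\<bar>)" for x i N
  proof -
    define n where "n = nat \<bar>int i - \<lfloor>x + N\<rfloor>\<bar>"
    \<comment> \<open>Rounding by the floor loses less than 1, which the summand 1 in
      \<open>\<phi>\<close> absorbs.\<close>
    have "real n \<le> 1 + \<bar>x - real i + N\<bar>" unfolding n_def by linarith
    then show ?thesis
      unfolding \<phi>_def g_def n_def[symmetric]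
      using powr_mono2'[of "-3/2" "real n" "1 + \<bar>x - real i + N\<bar>"]
        powr_mono2'[of "-3/2" 1 "1 + \<bar>x - real i + N\<bar>"]
      by (cases "n = 0") auto
  qed
  have \<phi>sum: "(\<Sum>i<n. \<phi> (x - real i + N)) \<le> 2 * suminf g" for n x N
  proof -
    have "(\<Sum>i<n. \<phi> (x - real i + N)) \<le> (\<Sum>i<n. g (nat \<bar>int i - \<lfloor>x + N\<rfloor>\<bar>))"
      by (intro sum_mono \<phi>)
    also have "\<dots> = (\<Sum>i\<in>int ` {..<n}. g (nat \<bar>i - \<lfloor>x + N\<rfloor>\<bar>))"
      by (simp add: sum.reindex)
    also have "\<dots> \<le> 2 * suminf g" by (intro sum_int_dist_le gs g0) auto
    finally show ?thesis .
  qed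
  have cube: "1 / (1 + norm (z - grid_corner N i j)) ^ 3
      \<le> \<phi> (Re z - real i + N) * \<phi> (Im z - real j + N)" for z N i j
  proof -
    define t where "t = 1 + norm (z - grid_corner N i j)"
    have t: "1 + \<bar>Re z - real i + N\<bar> \<le> t" "1 + \<bar>Im z - real j + N\<bar> \<le> t"
      using abs_Re_le_cmod[of "z - grid_corner N i j"] abs_Im_le_cmod[of "z - grid_corner N i j"]
      by (auto simp: t_def grid_corner_def algebra_simps)
    then have "t > 0" by linarith
    then have "1 / t ^ 3 = t powr (-3/2) * t powr (-3/2)"
      by (simp add: powr_minus_divide flip: powr_add powr_numeral)
    also have "\<dots> \<le> \<phi> (Re z - real i + N) * \<phi> (Im z - real j + N)"
      unfolding \<phi>_def using t by (intro mult_mono powr_mono2') auto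
    finally show ?thesis by (simp add: t_def)
  qed
  have "(\<Sum>i<2*N. \<Sum>j<2*N. 1 / (1 + norm (z - grid_corner N i j)) ^ 3) \<le> 2 * suminf g * (2 * suminf g)" for N z
  proof -
    have "(\<Sum>i<2*N. \<Sum>j<2*N. 1 / (1 + norm (z - grid_corner N i j)) ^ 3)
        \<le> (\<Sum>i<2*N. \<Sum>j<2*N. \<phi> (Re z - real i + N) * \<phi> (Im z - real j + N))"
      by (intro sum_mono cube)
    also have "\<dots> = (\<Sum>i<2*N. \<phi> (Re z - real i + N)) * (\<Sum>j<2*N. \<phi> (Im z - real j + N))"
      by (simp add: sum_product)
    also have "\<dots> \<le> 2 * suminf g * (2 * suminf g)"
      using suminf_nonneg[OF gs g0]
      by (intro mult_mono \<phi>sum sum_nonneg) (auto simp: \<phi>_def)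
    finally show ?thesis .
  qed
  moreover have "0 \<le> 2 * suminf g * (2 * suminf g)" using suminf_nonneg[OF gs g0] by simp
  ultimately show ?thesis by blast
qed

text \<open>\<open>C\<close> is chosen before \<open>L\<close> and \<open>F\<close>; this
  independence is what makes rescaling work in Mergelyan's theorem. Each cell either lies where
  \<open>F\<close> is holomorphic or comes close to the complement, so the local estimates apply to
  all cells and the lattice sum bounds the total.\<close>

lemma lipschitz_poly_approx:
  "\<exists>C. \<forall>L F M R. compact L \<longrightarrow> connected (- L) \<longrightarrow> (\<forall>x y. norm (F x - F y) \<le> M * norm (x - y)) \<longrightarrow>
     (\<forall>z. R \<le> norm z \<longrightarrow> F z = 0) \<longrightarrow> F holomorphic_on {z. 2 < infdist z (- L)} \<longrightarrow>
     (\<exists>\<Psi>. poly_approx L \<Psi> \<and> (\<forall>z\<in>L. norm (F z - \<Psi> z) \<le> C * M))"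
proof -
  obtain S where S: "S \<ge> 0"
    "\<And>N z. (\<Sum>i<2*N. \<Sum>j<2*N. 1 / (1 + norm (z - grid_corner N i j)) ^ 3) \<le> S"
    using lattice_sum_bound by blast
  show ?thesis
  proof (intro exI[of _ "10 ^ 10 * S"] allI impI)
    fix L and F :: "complex \<Rightarrow> complex" and M R :: real
    assume L: "compact L" "connected (- L)" and F: "\<forall>x y. norm (F x - F y) \<le> M * norm (x - y)"
      and R: "\<forall>z. R \<le> norm z \<longrightarrow> F z = 0" and hol: "F holomorphic_on {z. 2 < infdist z (- L)}"
    have M: "M \<ge> 0" using order_trans[OF norm_ge_zero F[rule_format, of 1 0]] by simp
    have "M-lipschitz_on UNIV F" using F M by (auto simp: lipschitz_on_def dist_norm)
    then have contF: "continuous_on UNIV F" by (rule lipschitz_on_continuous_on)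
    obtain B where B: "\<And>z. z \<in> L \<Longrightarrow> norm z \<le> B"
      using compact_imp_bounded[OF L(1)] by (auto simp: bounded_iff)
    have neL: "- L \<noteq> {}"
      using cobounded_imp_unbounded[of "- L"] compact_imp_bounded[OF L(1)] by auto
    obtain N :: nat where N: "max R B < N" using reals_Archimedean2 by blast
    define q where "q = grid_corner N"
    have "\<exists>V \<Psi>. open V \<and> L \<subseteq> V \<and> continuous_on V \<Psi> \<and> poly_approx L \<Psi> \<and>
      (\<forall>z\<in>V. z \<notin> path_image (unit_rect (q i j)) \<longrightarrow>
         norm (cell_part F (q i j) z - \<Psi> z) \<le> 10 ^ 10 * M * (1 / (1 + norm (z - q i j)) ^ 3))" for i j
    proof (rule cell_part_approx[OF L])
      show "F holomorphic_on unit_cell (q i j) \<or> (\<exists>p\<in>unit_cell (q i j). \<exists>w. w \<notin> L \<and> norm (p - w) \<le> 3)"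
      proof (cases "\<forall>p\<in>unit_cell (q i j). 2 < infdist p (- L)")
        case True
        then have "F holomorphic_on unit_cell (q i j)"
          by (intro holomorphic_on_subset[OF hol]) auto
        then show ?thesis ..
      next
        case False
        \<comment> \<open>The infimum need not be attained, so the bound 2 is relaxed to 3 to obtain
          an actual point \<open>w\<close>.\<close>
        then obtain p where p: "p \<in> unit_cell (q i j)" "infdist p (- L) < 3" by force
        then obtain w where "w \<in> - L" "dist p w < 3"
          using neL by (auto simp: infdist_notempty cInf_less_iff)
        with p show ?thesis by (auto simp: dist_norm intro: less_imp_le)
      qed
    qed (use F in auto)
    then obtain V \<Psi> where V: "\<And>i j. open (V i j)" "\<And>i j. L \<subseteq> V i j"
      and \<Psi>: "\<And>i j. continuous_on (V i j) (\<Psi> i j)" "\<And>i j. poly_approx L (\<Psi> i j)"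
      "\<And>i j z. z \<in> V i j \<Longrightarrow> z \<notin> path_image (unit_rect (q i j)) \<Longrightarrow>
         norm (cell_part F (q i j) z - \<Psi> i j z) \<le> 10 ^ 10 * M * (1 / (1 + norm (z - q i j)) ^ 3)"
      by metis
    define W where "W = ball 0 (real N) \<inter> (\<Inter>i<2*N. \<Inter>j<2*N. V i j)"
    define T where "T = (\<lambda>z. \<Sum>i<2*N. \<Sum>j<2*N. \<Psi> i j z)"
    define D where "D = (\<Union>i<2*N. \<Union>j<2*N. path_image (unit_rect (q i j)))"
    have W: "open W" unfolding W_def by (intro open_Int open_ball open_INT finite_lessThan ballI V)
    have LW: "L \<subseteq> W" using V(2) B N by (force simp: W_def)
    have contT: "continuous_on W T"
      unfolding T_def
      by (intro continuous_on_sum continuous_on_subset[OF \<Psi>(1)]) (auto simp: W_def)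
    have bound: "norm (F z - T z) \<le> 10 ^ 10 * S * M" if z: "z \<in> W" "z \<notin> D" for z
    proof -
      have "\<bar>Re z\<bar> < N" "\<bar>Im z\<bar> < N"
        using z(1) abs_Re_le_cmod[of z] abs_Im_le_cmod[of z] by (auto simp: W_def)
      moreover have "F w = 0" if "real N \<le> \<bar>Re w\<bar> \<or> real N \<le> \<bar>Im w\<bar>" for w
        using that abs_Re_le_cmod[of w] abs_Im_le_cmod[of w] N R by auto
      ultimately have "F z = (\<Sum>i<2*N. \<Sum>j<2*N. cell_part F (q i j) z)"
        unfolding q_def using z(2) by (intro grid_sum[symmetric] contF) (auto simp: D_def q_def)
      then have "norm (F z - T z) = norm (\<Sum>i<2*N. \<Sum>j<2*N. cell_part F (q i j) z - \<Psi> i j z)"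
        by (simp add: T_def sum_subtractf)
      also have "\<dots> \<le> (\<Sum>i<2*N. \<Sum>j<2*N. 10 ^ 10 * M * (1 / (1 + norm (z - q i j)) ^ 3))"
        using z by (intro sum_norm_le \<Psi>(3)) (auto simp: W_def D_def)
      also have "\<dots> = 10 ^ 10 * M * (\<Sum>i<2*N. \<Sum>j<2*N. 1 / (1 + norm (z - q i j)) ^ 3)"
        by (simp add: sum_distrib_left)
      also have "\<dots> \<le> 10 ^ 10 * M * S"
        unfolding q_def using M by (intro mult_left_mono S(2)) auto
      finally show ?thesis by (simp add: mult_ac)
    qed
    \<comment> \<open>The estimate is still missing on the grid lines. They form a null set, whereas
      by continuity a violation at a point of \<open>L\<close> would persist on a nonempty open
      subset of \<open>W\<close>.\<close>
    have "negligible D"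
      unfolding D_def unit_rect_image
      by (intro negligible_Union finite_imageI) (auto intro!: negligible_Union negligible_frontier_interval)
    have "norm (F z - T z) \<le> 10 ^ 10 * S * M" if "z \<in> L" for z
    proof (rule ccontr)
      define X where "X = {x \<in> W. 10 ^ 10 * S * M < norm (F x - T x)}"
      assume "\<not> norm (F z - T z) \<le> 10 ^ 10 * S * M"
      then have "z \<in> X" using that LW by (auto simp: X_def)
      moreover have "open X"
      proof -
        have "openin (top_of_set W) (W \<inter> (\<lambda>x. norm (F x - T x)) -` {10 ^ 10 * S * M<..})"
          by (intro continuous_openin_preimage_gen continuous_intros contT continuous_on_subset[OF contF]) auto
        moreover have "W \<inter> (\<lambda>x. norm (F x - T x)) -` {10 ^ 10 * S * M<..} = X"
          by (auto simp: X_def)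
        ultimately show ?thesis using W by (simp add: openin_open_eq)
      qed
      moreover have "X \<subseteq> D" using bound by (force simp: X_def)
      ultimately show False
        using \<open>negligible D\<close> negligible_subset open_not_negligible by blast
    qed
    moreover have "poly_approx L T" unfolding T_def by (intro poly_approx_sum \<Psi>(2))
    ultimately show "\<exists>\<Psi>. poly_approx L \<Psi> \<and> (\<forall>z\<in>L. norm (F z - \<Psi> z) \<le> 10 ^ 10 * S * M)" by blast
  qed
qed

section \<open>Lipschitz regularization\<close>

text \<open>The segment between the points is cut into equal pieces of length at most 1; fewer than
  \<open>norm (x - y) + 1\<close> pieces suffice.\<close>

lemma uniform_step_bound:
  fixes f :: "'a :: real_normed_vector \<Rightarrow> 'b :: real_normed_vector"
  assumes f: "\<And>x y. norm (x - y) \<le> 1 \<Longrightarrow> norm (f x - f y) < 1"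
  shows "norm (f x - f y) \<le> norm (x - y) + 1"
proof -
  have *: "norm (f x - f y) \<le> n" if "norm (x - y) \<le> real n" for n x y
    using that
  proof (induction n arbitrary: x)
    case (Suc n)
    \<comment> \<open>\<open>u\<close> is the division point next to \<open>x\<close> when the
      segment is cut into \<open>Suc n\<close> equal pieces.\<close>
    define t where "t = real n / Suc n"
    define u where "u = y + t *\<^sub>R (x - y)"
    have "x - u = (1 - t) *\<^sub>R (x - y)" "u - y = t *\<^sub>R (x - y)"
      by (auto simp: u_def algebra_simps)
    then have nx: "norm (x - u) = (1 - t) * norm (x - y)" and nu: "norm (u - y) = t * norm (x - y)"
      by (auto simp: t_def)
    have "norm (x - u) \<le> (1 - t) * Suc n"
      unfolding nx using Suc.prems by (intro mult_left_mono) (auto simp: t_def)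
    then have "norm (x - u) \<le> 1" by (simp add: t_def field_simps)
    moreover have "norm (u - y) \<le> t * Suc n"
      unfolding nu using Suc.prems by (intro mult_left_mono) (auto simp: t_def)
    then have "norm (u - y) \<le> n" by (simp add: t_def)
    ultimately have "norm (f x - f u) < 1" "norm (f u - f y) \<le> n" using f Suc.IH by auto
    then show ?case using norm_triangle_ineq[of "f x - f u" "f u - f y"] by simp
  qed simp
  have "norm (x - y) \<le> nat \<lceil>norm (x - y)\<rceil>" by linarith
  then have "norm (f x - f y) \<le> nat \<lceil>norm (x - y)\<rceil>" by (rule *)
  also have "\<dots> \<le> norm (x - y) + 1" using norm_ge_zero[of "x - y"] by linarith
  finally show ?thesis .
qed

text \<open>\<open>g\<close> is the infimal convolution of \<open>u\<close> with the norm, that is,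
  the largest 1-Lipschitz function below \<open>u\<close>; the hypothesis on \<open>u\<close> says
  that it drops by at most 1.\<close>

lemma lipschitz_regularization_real:
  fixes u :: "'a :: real_normed_vector \<Rightarrow> real"
  assumes u: "\<And>x y. \<bar>u x - u y\<bar> \<le> norm (x - y) + 1"
    and supp: "\<And>x. R \<le> norm x \<Longrightarrow> u x = 0" and bnd: "\<And>x. \<bar>u x\<bar> \<le> B"
  obtains g where "\<And>x y. \<bar>g x - g y\<bar> \<le> norm (x - y)" "\<And>x. \<bar>g x - u x\<bar> \<le> 1"
    "\<And>x. R + B \<le> norm x \<Longrightarrow> g x = 0"
proof -
  define g where "g = (\<lambda>x. INF w. u w + norm (x - w))"
  have lower: "u x - 1 \<le> u w + norm (x - w)" for x w
    using u[of x w] by linarith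
  then have bdd: "bdd_below (range (\<lambda>w. u w + norm (x - w)))" for x
    by (intro bdd_belowI) auto
  have le: "g x \<le> u w + norm (x - w)" for x w
    unfolding g_def by (intro cINF_lower bdd) auto
  have ge: "c \<le> g x" if "\<And>w. c \<le> u w + norm (x - w)" for x c
    unfolding g_def using that by (intro cINF_greatest) auto
  have lip: "g x \<le> g y + norm (x - y)" for x y
  proof -
    have "g x - norm (x - y) \<le> u w + norm (y - w)" for w
      using le[of x w] norm_triangle_ineq[of "x - y" "y - w"] by simp
    then have "g x - norm (x - y) \<le> g y" by (rule ge)
    then show ?thesis by simp
  qed
  show thesis
  proof
    show "\<bar>g x - g y\<bar> \<le> norm (x - y)" for x y
      using lip[of x y] lip[of y x] by (simp add: norm_minus_commute abs_le_iff)
    show "\<bar>g x - u x\<bar> \<le> 1" for x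
      using le[of x x] ge[OF lower, of x] by simp
    \<comment> \<open>For \<open>norm w < R\<close> the distance from \<open>x\<close> to
      \<open>w\<close> exceeds \<open>B\<close> and outweighs \<open>u w \<ge> - B\<close>; for
      other \<open>w\<close> the value \<open>u w\<close> is 0.\<close>
    fix x :: 'a assume x: "R + B \<le> norm x"
    have B: "B \<ge> 0" using bnd[of x] by linarith
    have "0 \<le> u w + norm (x - w)" for w
    proof (cases "R \<le> norm w")
      case False
      have "norm x \<le> norm (x - w) + norm w" by norm
      then show ?thesis using False x bnd[of w] by linarith
    qed (simp add: supp)
    then have "0 \<le> g x" by (rule ge)
    moreover have "g x \<le> 0" using le[of x x] supp[of x] x B by simp
    ultimately show "g x = 0" by simp
  qed
qed

lemma lipschitz_regularization:
  fixes f :: "complex \<Rightarrow> complex"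
  assumes f: "\<And>x y. norm (x - y) \<le> 1 \<Longrightarrow> norm (f x - f y) < 1"
    and supp: "\<And>x. R \<le> norm x \<Longrightarrow> f x = 0" and bnd: "\<And>x. norm (f x) \<le> B"
  obtains g where "\<And>x y. norm (g x - g y) \<le> 2 * norm (x - y)" "\<And>x. norm (g x - f x) \<le> 2"
    "\<And>x. R + B \<le> norm x \<Longrightarrow> g x = 0"
proof -
  have f1: "norm (f x - f y) \<le> norm (x - y) + 1" for x y
    by (rule uniform_step_bound[OF f])
  have "\<bar>Re (f x) - Re (f y)\<bar> \<le> norm (x - y) + 1" "\<bar>Im (f x) - Im (f y)\<bar> \<le> norm (x - y) + 1" for x y
    using f1[of x y] abs_Re_le_cmod[of "f x - f y"] abs_Im_le_cmod[of "f x - f y"] by simp_all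
  moreover have "\<bar>Re (f x)\<bar> \<le> B" "\<bar>Im (f x)\<bar> \<le> B" for x
    using bnd[of x] abs_Re_le_cmod[of "f x"] abs_Im_le_cmod[of "f x"] by linarith+
  moreover have "Re (f x) = 0" "Im (f x) = 0" if "R \<le> norm x" for x
    using supp[OF that] by auto
  ultimately obtain g1 g2 where g1: "\<And>x y. \<bar>g1 x - g1 y\<bar> \<le> norm (x - y)" "\<And>x. \<bar>g1 x - Re (f x)\<bar> \<le> 1"
      "\<And>x. R + B \<le> norm x \<Longrightarrow> g1 x = 0"
    and g2: "\<And>x y. \<bar>g2 x - g2 y\<bar> \<le> norm (x - y)" "\<And>x. \<bar>g2 x - Im (f x)\<bar> \<le> 1"
      "\<And>x. R + B \<le> norm x \<Longrightarrow> g2 x = 0"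
    using lipschitz_regularization_real[of "\<lambda>x. Re (f x)" R B]
      lipschitz_regularization_real[of "\<lambda>x. Im (f x)" R B] by metis
  show thesis
  proof (rule that[of "\<lambda>x. Complex (g1 x) (g2 x)"])
    show "norm (Complex (g1 x) (g2 x) - Complex (g1 y) (g2 y)) \<le> 2 * norm (x - y)" for x y
      using cmod_le[of "Complex (g1 x) (g2 x) - Complex (g1 y) (g2 y)"] g1(1)[of x y] g2(1)[of x y] by simp
    show "norm (Complex (g1 x) (g2 x) - f x) \<le> 2" for x
      using cmod_le[of "Complex (g1 x) (g2 x) - f x"] g1(2)[of x] g2(2)[of x] by simp
    show "Complex (g1 x) (g2 x) = 0" if "R + B \<le> norm x" for x
      using g1(3)[OF that] g2(3)[OF that] by (simp add: complex_eq_iff)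
  qed
qed

text \<open>Schwarz's lemma for \<open>\<xi> \<mapsto> f (z + \<xi>) - f z\<close>, which maps the
  unit disc into itself and fixes 0.\<close>

lemma holomorphic_step_lipschitz:
  assumes hol: "f holomorphic_on ball z 1" and f: "\<And>x. norm (x - z) < 1 \<Longrightarrow> norm (f x - f z) < 1"
    and y: "norm (y - z) < 1"
  shows "norm (f y - f z) \<le> norm (y - z)"
proof -
  define h where "h = (\<lambda>\<xi>. f (z + \<xi>) - f z)"
  have "h holomorphic_on ball 0 1"
    unfolding h_def
  proof (intro holomorphic_intros)
    show "(\<lambda>\<xi>. f (z + \<xi>)) holomorphic_on ball 0 1"
      by (intro holomorphic_on_compose_gen[OF _ hol, unfolded o_def] holomorphic_intros) (auto simp: dist_norm)
  qed
  from Schwarz_Lemma(1)[OF this, of "y - z"] y f[of "z + _"] show ?thesis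
    by (simp add: h_def)
qed

section \<open>Mergelyan's theorem\<close>

text \<open>\<open>f\<close> is kept deep inside \<open>L\<close> and replaced by its regularization
  \<open>g\<close> elsewhere. The transition happens where unit discs still lie in the interior, so
  that \<open>f\<close> is itself Lipschitz there and the glued function \<open>F\<close> has an
  absolute Lipschitz constant.\<close>

lemma mergelyan_unit_scale:
  "\<exists>C. \<forall>L f R. compact L \<longrightarrow> connected (- L) \<longrightarrow>
     (\<forall>x y. norm (x - y) \<le> 1 \<longrightarrow> norm (f x - f y) < 1) \<longrightarrow>
     (\<forall>z. R \<le> norm z \<longrightarrow> f z = 0) \<longrightarrow> f holomorphic_on interior L \<longrightarrow>
     (\<exists>\<Psi>. poly_approx L \<Psi> \<and> (\<forall>z\<in>L. norm (f z - \<Psi> z) \<le> C))"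
proof -
  obtain C where C: "\<And>L F M R. compact L \<Longrightarrow> connected (- L) \<Longrightarrow>
     (\<And>x y. norm (F x - F y) \<le> M * norm (x - y)) \<Longrightarrow> (\<And>z. R \<le> norm z \<Longrightarrow> F z = 0) \<Longrightarrow>
     F holomorphic_on {z. 2 < infdist z (- L)} \<Longrightarrow>
     \<exists>\<Psi>. poly_approx L \<Psi> \<and> (\<forall>z\<in>L. norm (F z - \<Psi> z) \<le> C * M)"
    using lipschitz_poly_approx by metis
  show ?thesis
  proof (intro exI[of _ "2 + C * 7"] allI impI)
    fix L and f :: "complex \<Rightarrow> complex" and R :: real
    assume L: "compact L" "connected (- L)"
      and f: "\<forall>x y. norm (x - y) \<le> 1 \<longrightarrow> norm (f x - f y) < 1"
      and R: "\<forall>z. R \<le> norm z \<longrightarrow> f z = 0" and hol: "f holomorphic_on interior L"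
    \<comment> \<open>The comparison point \<open>of_real \<bar>R\<bar>\<close> has norm at least
      \<open>R\<close>, so \<open>f\<close> vanishes there.\<close>
    have bnd: "norm (f x) \<le> norm x + \<bar>R\<bar> + 1" for x
      using uniform_step_bound[of f x "of_real \<bar>R\<bar>"] norm_triangle_ineq4[of x "of_real \<bar>R\<bar>"] f R by simp
    define B where "B = 2 * \<bar>R\<bar> + 1"
    have B: "norm (f x) \<le> B" for x
    proof (cases "R \<le> norm x")
      case False
      then show ?thesis using bnd[of x] by (simp add: B_def)
    qed (simp add: R B_def)
    obtain g where g: "\<And>x y. norm (g x - g y) \<le> 2 * norm (x - y)" "\<And>x. norm (g x - f x) \<le> 2"
      "\<And>x. R + B \<le> norm x \<Longrightarrow> g x = 0"
      using lipschitz_regularization[of f R B] f R B by blast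
    define \<delta> where "\<delta> = (\<lambda>z. infdist z (- L))"
    \<comment> \<open>A cutoff in the depth \<open>\<delta>\<close>: 0 up to depth 1, and 1 from
      depth 2 on.\<close>
    define \<theta> where "\<theta> = (\<lambda>z. max 0 (min 1 (\<delta> z - 1)))"
    define k where "k = (\<lambda>z. f z - g z)"
    define F where "F = (\<lambda>z. g z + of_real (\<theta> z) * k z)"
    have k2: "norm (k x) \<le> 2" for x using g(2)[of x] by (simp add: k_def norm_minus_commute)
    have \<theta>: "0 \<le> \<theta> x" "\<theta> x \<le> 1" for x by (auto simp: \<theta>_def)
    have \<delta>: "\<bar>\<delta> x - \<delta> y\<bar> \<le> norm (x - y)" for x y
      using infdist_triangle_abs[of x "- L" y] by (simp add: \<delta>_def dist_norm)
    have \<theta>lip: "\<bar>\<theta> x - \<theta> y\<bar> \<le> norm (x - y)" for x y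
      using \<delta>[of x y] by (simp add: \<theta>_def)
    have deep: "ball x r \<subseteq> interior L" if "r \<le> \<delta> x" for x r
    proof (rule interior_maximal)
      show "ball x r \<subseteq> L"
      proof
        fix y assume y: "y \<in> ball x r"
        show "y \<in> L"
        proof (rule ccontr)
          assume "y \<notin> L"
          then have "\<delta> x \<le> dist x y" unfolding \<delta>_def by (intro infdist_le) auto
          then show False using y that by auto
        qed
      qed
    qed auto
    \<comment> \<open>\<open>x\<close> is the deeper point, so only its unit disc needs to lie in
      \<open>L\<close>. The constant 7 is 2 from \<open>g\<close> plus 2 + 3 from the product of
      \<open>\<theta>\<close> and \<open>k\<close>; for distant points 2 + 4 suffices.\<close>
    have lip: "norm (F x - F y) \<le> 7 * norm (x - y)" if "\<delta> y \<le> \<delta> x" for x y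
    proof -
      have gxy: "norm (F x - F y) \<le> 2 * norm (x - y) + norm (of_real (\<theta> x) * k x - of_real (\<theta> y) * k y)"
        using g(1)[of x y] norm_triangle_ineq[of "g x - g y" "of_real (\<theta> x) * k x - of_real (\<theta> y) * k y"]
        by (simp add: F_def algebra_simps)
      consider "1 \<le> norm (x - y)" | "norm (x - y) < 1" "\<delta> x \<le> 1" | "norm (x - y) < 1" "1 < \<delta> x"
        by linarith
      then show ?thesis
      proof cases
        case 1
        have "norm (of_real (\<theta> z) * k z) \<le> 1 * 2" for z
          unfolding norm_mult using \<theta>[of z] k2[of z] by (intro mult_mono) auto
        from this[of x] this[of y] show ?thesis
          using gxy 1 norm_triangle_ineq4[of "of_real (\<theta> x) * k x" "of_real (\<theta> y) * k y"] by linarith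
      next
        case 2
        then have "\<theta> x = 0" "\<theta> y = 0" using that by (auto simp: \<theta>_def)
        then have "norm (of_real (\<theta> x) * k x - of_real (\<theta> y) * k y) = 0" by simp
        then show ?thesis using gxy norm_ge_zero[of "x - y"] by linarith
      next
        case 3
        have "f holomorphic_on ball x 1" using hol deep[of 1 x] 3 holomorphic_on_subset by force
        then have "norm (f y - f x) \<le> norm (y - x)"
          using 3 f by (intro holomorphic_step_lipschitz) (auto simp: norm_minus_commute)
        then have kxy: "norm (k x - k y) \<le> 3 * norm (x - y)"
          using g(1)[of x y] norm_triangle_ineq4[of "f x - f y" "g x - g y"]
          by (simp add: k_def norm_minus_commute algebra_simps)
        have "of_real (\<theta> x) * k x - of_real (\<theta> y) * k y
            = of_real (\<theta> x - \<theta> y) * k x + of_real (\<theta> y) * (k x - k y)"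
          by (simp add: algebra_simps)
        also have "norm \<dots> \<le> norm (of_real (\<theta> x - \<theta> y) * k x) + norm (of_real (\<theta> y) * (k x - k y))"
          by (rule norm_triangle_ineq)
        also have "\<dots> \<le> norm (x - y) * 2 + 1 * (3 * norm (x - y))"
          unfolding norm_mult norm_of_real using \<theta>lip[of x y] \<theta>[of y] k2[of x] kxy
          by (intro add_mono mult_mono) auto
        finally show ?thesis using gxy by linarith
      qed
    qed
    have F: "norm (F x - F y) \<le> 7 * norm (x - y)" for x y
      using lip[of x y] lip[of y x] by (metis linear norm_minus_commute)
    have "F z = 0" if "max R (R + B) \<le> norm z" for z
      using that R g(3)[of z] by (simp add: F_def k_def)
    moreover have "F holomorphic_on {z. 2 < infdist z (- L)}"
    proof (rule holomorphic_transform)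
      show "f holomorphic_on {z. 2 < infdist z (- L)}"
      proof (rule holomorphic_on_subset[OF hol], rule subsetI)
        fix z assume "z \<in> {z. 2 < infdist z (- L)}"
        then show "z \<in> interior L" using deep[of 2 z] centre_in_ball[of z 2] by (auto simp: \<delta>_def)
      qed
    qed (auto simp: F_def \<theta>_def \<delta>_def k_def)
    ultimately obtain \<Psi> where \<Psi>: "poly_approx L \<Psi>" "\<And>z. z \<in> L \<Longrightarrow> norm (F z - \<Psi> z) \<le> C * 7"
      using C[OF L F] by blast
    have "norm (f z - F z) \<le> 2" for z
    proof -
      have "f z - F z = of_real (1 - \<theta> z) * k z" by (simp add: F_def k_def algebra_simps)
      then have "norm (f z - F z) \<le> 1 * 2"
        unfolding \<open>f z - F z = _\<close> norm_mult norm_of_real using \<theta>[of z] k2[of z] by (intro mult_mono) auto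
      then show ?thesis by simp
    qed
    then have "norm (f z - \<Psi> z) \<le> 2 + C * 7" if "z \<in> L" for z
      using \<Psi>(2)[OF that] norm_triangle_ineq[of "f z - F z" "F z - \<Psi> z"] by (smt (verit) diff_add_cancel add_diff_eq)
    with \<Psi>(1) show "\<exists>\<Psi>. poly_approx L \<Psi> \<and> (\<forall>z\<in>L. norm (f z - \<Psi> z) \<le> 2 + C * 7)" by blast
  qed
qed

lemma poly_approx_compose_poly:
  assumes "poly_approx L f" "\<And>z. z \<in> A \<Longrightarrow> poly p z \<in> L"
  shows "poly_approx A (\<lambda>z. f (poly p z))"
  unfolding poly_approx_def
proof (intro allI impI)
  fix e :: real assume "e > 0"
  then obtain q where "\<forall>z\<in>L. norm (f z - poly q z) < e"
    using assms(1) unfolding poly_approx_def by blast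
  then have "\<forall>z\<in>A. norm (f (poly p z) - poly (pcompose q p) z) < e"
    using assms(2) by (simp add: poly_pcompose)
  then show "\<exists>q. \<forall>z\<in>A. norm (f (poly p z) - poly q z) < e" by blast
qed

text \<open>\<open>f\<close> is set to 0 outside a large ball and the gap is filled by Tietze's
  theorem; vanishing outside a ball makes the result uniformly continuous on the whole
  plane.\<close>

lemma compact_support_extension:
  fixes f :: "complex \<Rightarrow> complex"
  assumes "compact L" "continuous_on L f"
  obtains g R where "\<And>z. z \<in> L \<Longrightarrow> g z = f z" "\<And>z. R \<le> norm z \<Longrightarrow> g z = 0"
    "\<And>e. e > 0 \<Longrightarrow> \<exists>d>0. \<forall>x y. norm (x - y) \<le> d \<longrightarrow> norm (g x - g y) < e"
proof -
  obtain R0 where R0: "\<And>z. z \<in> L \<Longrightarrow> norm z \<le> R0"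
    using compact_imp_bounded[OF assms(1)] by (auto simp: bounded_iff)
  obtain B0 where B0: "\<And>z. z \<in> L \<Longrightarrow> norm (f z) \<le> B0"
    using compact_imp_bounded[OF compact_continuous_image[OF assms(2,1)]] by (auto simp: bounded_iff)
  define R where "R = R0 + 1"
  let ?f = "\<lambda>z. if z \<in> L then f z else 0"
  have "continuous_on (L \<union> - ball 0 R) ?f"
    using assms compact_imp_closed R0
    by (intro continuous_on_cases) (force simp: R_def)+
  moreover have "closedin (top_of_set UNIV) (L \<union> - ball 0 R)"
    using compact_imp_closed[OF assms(1)] by auto
  moreover have "norm (?f z) \<le> max 0 B0" for z
    using B0 by (auto simp: le_max_iff_disj)
  ultimately obtain g where g: "continuous_on UNIV g" "\<And>z. z \<in> L \<union> - ball 0 R \<Longrightarrow> g z = ?f z"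
    using Tietze[of "L \<union> - ball 0 R" ?f UNIV "max 0 B0"] by (metis max.cobounded1)
  have gR: "g z = 0" if "R \<le> norm z" for z
    using g(2)[of z] R0[of z] that by (force simp: R_def)
  show thesis
  proof (rule that[of g R])
    fix e :: real assume "e > 0"
    have "uniformly_continuous_on (cball 0 (R + 1)) g"
      by (intro compact_uniformly_continuous continuous_on_subset[OF g(1)]) auto
    then obtain d where d: "d > 0" "\<And>x y. x \<in> cball 0 (R + 1) \<Longrightarrow> y \<in> cball 0 (R + 1) \<Longrightarrow> dist x y < d \<Longrightarrow> dist (g x) (g y) < e"
      using \<open>e > 0\<close> unfolding uniformly_continuous_on_def by (metis dist_commute)
    \<comment> \<open>placeholder\<close>
    show "\<exists>d>0. \<forall>x y. norm (x - y) \<le> d \<longrightarrow> norm (g x - g y) < e"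
    proof (intro exI[of _ "min (d / 2) 1"] conjI allI impI)
      fix x y :: complex assume xy: "norm (x - y) \<le> min (d / 2) 1"
      show "norm (g x - g y) < e"
      proof (cases "R \<le> norm x \<and> R \<le> norm y")
        case False
        then have "x \<in> cball 0 (R + 1)" "y \<in> cball 0 (R + 1)"
          using xy norm_triangle_ineq3[of x y] by auto
        then show ?thesis using d(2)[of x y] xy d(1) by (simp add: dist_norm)
      qed (use gR \<open>e > 0\<close> in auto)
    qed (use d in auto)
  qed (use g gR in auto)
qed

theorem mergelyan:
  assumes L: "compact L" "connected (- L)"
    and f: "continuous_on L f" "f holomorphic_on interior L"
  shows "poly_approx L f"
proof (rule poly_approx_limit)
  fix e :: real assume "e > 0"
  obtain C where C: "\<And>L f R. compact L \<Longrightarrow> connected (- L) \<Longrightarrow>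
     (\<And>x y. norm (x - y) \<le> 1 \<Longrightarrow> norm (f x - f y) < 1) \<Longrightarrow>
     (\<And>z. R \<le> norm z \<Longrightarrow> f z = 0) \<Longrightarrow> f holomorphic_on interior L \<Longrightarrow>
     \<exists>\<Psi>. poly_approx L \<Psi> \<and> (\<forall>z\<in>L. norm (f z - \<Psi> z) \<le> C)"
    using mergelyan_unit_scale by metis
  obtain g R where g: "\<And>z. z \<in> L \<Longrightarrow> g z = f z" "\<And>z. R \<le> norm z \<Longrightarrow> g z = 0"
    "\<And>e. e > 0 \<Longrightarrow> \<exists>d>0. \<forall>x y. norm (x - y) \<le> d \<longrightarrow> norm (g x - g y) < e"
    by (rule compact_support_extension[OF L(1) f(1)]) (rule that)
  define \<eta> where "\<eta> = e / (\<bar>C\<bar> + 1)"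
  have \<eta>: "\<eta> > 0" using \<open>e > 0\<close> by (simp add: \<eta>_def)
  obtain d where d: "d > 0" "\<And>x y. norm (x - y) \<le> d \<Longrightarrow> norm (g x - g y) < \<eta>"
    using g(3)[OF \<eta>] by blast
  define L' where "L' = (\<lambda>x. (1 / d) *\<^sub>R x) ` L"
  define h where "h = (\<lambda>x. g (d *\<^sub>R x) / \<eta>)"
  have "compact L'" unfolding L'_def by (rule compact_scaling[OF L(1)])
  moreover have "connected (- L')"
  proof -
    have "bij (\<lambda>x :: complex. (1 / d) *\<^sub>R x)"
      using d(1) by (intro bij_betw_byWitness[where f' = "\<lambda>x. d *\<^sub>R x"]) auto
    then have "- L' = (\<lambda>x. (1 / d) *\<^sub>R x) ` (- L)" unfolding L'_def by (simp add: bij_image_Compl_eq)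
    then show ?thesis by (simp add: L(2) connected_continuous_image continuous_on_scaleR)
  qed
  moreover have "norm (h x - h y) < 1" if "norm (x - y) \<le> 1" for x y
  proof -
    have "norm (d *\<^sub>R x - d *\<^sub>R y) = d * norm (x - y)"
      using d(1) by (simp flip: scaleR_diff_right)
    also have "\<dots> \<le> d" using that d(1) by simp
    finally have "norm (g (d *\<^sub>R x) - g (d *\<^sub>R y)) < \<eta>" by (rule d(2))
    then show ?thesis
      using \<eta> by (simp add: h_def norm_divide divide_less_eq flip: diff_divide_distrib)
  qed
  moreover have "h z = 0" if "R / d \<le> norm z" for z
    using that d(1) g(2)[of "d *\<^sub>R z"] by (simp add: h_def divide_le_eq mult.commute)
  moreover have "h holomorphic_on interior L'"
  proof -
    have "(\<lambda>x. d *\<^sub>R x) ` interior L' \<subseteq> interior L"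
    proof (rule interior_maximal)
      show "(\<lambda>x. d *\<^sub>R x) ` interior L' \<subseteq> L"
        using interior_subset[of L'] d(1) by (auto simp: L'_def)
      show "open ((\<lambda>x. d *\<^sub>R x) ` interior L')" using d(1) by (intro open_scaling) auto
    qed
    moreover have "g holomorphic_on interior L"
      using f(2) g(1) interior_subset by (elim holomorphic_transform) force
    ultimately have "(\<lambda>x. g (d *\<^sub>R x)) holomorphic_on interior L'"
      using holomorphic_on_compose_gen[of "\<lambda>x. d *\<^sub>R x" "interior L'" g "interior L"]
      by (auto simp: o_def scaleR_conv_of_real intro!: holomorphic_intros)
    then show ?thesis unfolding h_def using \<eta> by (intro holomorphic_intros) auto
  qed
  ultimately obtain \<Psi> where \<Psi>: "poly_approx L' \<Psi>" "\<And>z. z \<in> L' \<Longrightarrow> norm (h z - \<Psi> z) \<le> C"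
    using C by metis
  define p where "p = [:0, 1 / complex_of_real d:]"
  have eq: "poly p z = (1 / d) *\<^sub>R z" for z by (simp add: p_def scaleR_conv_of_real)
  have "poly_approx L (\<lambda>z. \<eta> * \<Psi> (poly p z))"
    by (intro poly_approx_cmult poly_approx_compose_poly[OF \<Psi>(1)] L) (simp only: L'_def eq, rule imageI)
  moreover have "norm (f z - \<eta> * \<Psi> (poly p z)) < e" if "z \<in> L" for z
  proof -
    have "(1 / d) *\<^sub>R z \<in> L'" unfolding L'_def using that by (rule imageI)
    moreover have "f z = \<eta> * h ((1 / d) *\<^sub>R z)" using g(1)[OF that] d(1) \<eta> by (simp add: h_def)
    ultimately have "norm (f z - \<eta> * \<Psi> ((1 / d) *\<^sub>R z)) \<le> \<eta> * C"
      using \<Psi>(2) \<eta> by (simp add: norm_mult flip: right_diff_distrib)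
    also have "\<dots> \<le> \<eta> * \<bar>C\<bar>" using \<eta> by simp
    also have "\<dots> < e" using \<open>e > 0\<close> by (simp add: \<eta>_def divide_simps)
    finally show ?thesis by (simp only: eq)
  qed
  ultimately show "\<exists>g. poly_approx L g \<and> (\<forall>z\<in>L. norm (f z - g z) < e)" by blast
qed

section \<open>Generators\<close>

definition rational_approx :: "complex set \<Rightarrow> (complex \<Rightarrow> complex) \<Rightarrow> bool" where
  "rational_approx K f \<longleftrightarrow>
     (\<forall>e>0. \<exists>p q. (\<forall>z\<in>K. poly q z \<noteq> 0) \<and> (\<forall>z\<in>K. norm (f z - poly p z / poly q z) < e))"

lemma R_algebra_iff:
  assumes "compact K"
  shows "f \<in> R_algebra K \<longleftrightarrow> f \<in> extensional K \<and> continuous_on K f \<and> rational_approx K f"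
proof -
  have "rational_restrictions K \<subseteq> {f \<in> extensional K. continuous_on K f}"
    by (auto simp: rational_restrictions_def cong: continuous_on_cong_simp intro!: continuous_intros)
  note iff = uniform_closure_iff[OF assms this]
  have "(\<exists>g\<in>rational_restrictions K. P g) \<longleftrightarrow>
      (\<exists>p q. (\<forall>z\<in>K. poly q z \<noteq> 0) \<and> P (restrict (\<lambda>z. poly p z / poly q z) K))" for P
    unfolding rational_restrictions_def by blast
  then show ?thesis
    unfolding R_algebra_def iff rational_approx_def by (simp add: dist_norm cong: ball_cong)
qed

lemma alg_closure_iff:
  assumes "compact K" "continuous_on K \<phi>"
  shows "f \<in> alg_closure K \<phi> \<longleftrightarrow> f \<in> extensional K \<and> continuous_on K f \<and>
    (\<forall>e>0. \<exists>p. \<forall>z\<in>K. norm (f z - poly p (\<phi> z)) < e)"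
proof -
  have "{restrict (\<lambda>z. poly p (\<phi> z)) K | p. True} \<subseteq> {f \<in> extensional K. continuous_on K f}"
    using assms(2) by (auto cong: continuous_on_cong_simp intro!: continuous_intros)
  note iff = uniform_closure_iff[OF assms(1) this]
  have "(\<exists>g\<in>{restrict (\<lambda>z. poly p (\<phi> z)) K | p. True}. P g) \<longleftrightarrow>
      (\<exists>p. P (restrict (\<lambda>z. poly p (\<phi> z)) K))" for P
    by blast
  then show ?thesis
    unfolding alg_closure_def iff by (simp add: dist_norm cong: ball_cong)
qed

lemma rational_approx_holomorphic:
  assumes "rational_approx K f"
  shows "f holomorphic_on interior K"
proof -
  have "\<exists>p q. (\<forall>z\<in>K. poly q z \<noteq> 0) \<and> (\<forall>z\<in>K. norm (f z - poly p z / poly q z) < 1 / Suc n)" for n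
    using assms unfolding rational_approx_def by simp
  then obtain p q where pq: "\<And>n z. z \<in> K \<Longrightarrow> poly (q n) z \<noteq> 0"
    "\<And>n z. z \<in> K \<Longrightarrow> norm (f z - poly (p n) z / poly (q n) z) < 1 / Suc n"
    by metis
  have ul: "uniform_limit K (\<lambda>n z. poly (p n) z / poly (q n) z) f sequentially"
    unfolding uniform_limit_iff
  proof (intro allI impI)
    fix e :: real assume "e > 0"
    then obtain N where N: "1 / Suc N < e" using nat_approx_posE by blast
    have "dist (poly (p n) z / poly (q n) z) (f z) < e" if "N \<le> n" "z \<in> K" for n z
    proof -
      have "1 / Suc n \<le> 1 / Suc N" using that(1) by (simp add: divide_simps)
      then show ?thesis using pq(2)[OF that(2), of n] N by (simp add: dist_norm norm_minus_commute)
    qed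
    then show "\<forall>\<^sub>F n in sequentially. \<forall>z\<in>K. dist (poly (p n) z / poly (q n) z) (f z) < e"
      unfolding eventually_sequentially by blast
  qed
  show ?thesis
  proof (rule holomorphic_uniform_sequence[OF open_interior])
    show "(\<lambda>z. poly (p n) z / poly (q n) z) holomorphic_on interior K" for n
      using pq(1) interior_subset by (intro holomorphic_intros) auto
    fix x assume "x \<in> interior K"
    then obtain d where "d > 0" "cball x d \<subseteq> interior K"
      using open_interior open_contains_cball by blast
    then show "\<exists>d>0. cball x d \<subseteq> interior K \<and>
        uniform_limit (cball x d) (\<lambda>n z. poly (p n) z / poly (q n) z) f sequentially"
      using uniform_limit_on_subset[OF ul] interior_subset by blast
  qed
qed

lemma poly_of_quotient:
  fixes r p q :: "'a :: field poly"
  shows "\<exists>s m. \<forall>z. poly q z \<noteq> 0 \<longrightarrow> poly r (poly p z / poly q z) = poly s z / poly (q ^ m) z"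
proof (induction r)
  case 0
  show ?case by (intro exI[of _ 0]) simp
next
  case (pCons a r)
  then obtain s m where "\<forall>z. poly q z \<noteq> 0 \<longrightarrow> poly r (poly p z / poly q z) = poly s z / poly (q ^ m) z"
    by blast
  then have "\<forall>z. poly q z \<noteq> 0 \<longrightarrow> poly (pCons a r) (poly p z / poly q z)
      = poly (smult a (q ^ Suc m) + p * s) z / poly (q ^ Suc m) z"
    by (simp add: field_simps)
  then show ?case by blast
qed

lemma rational_approx_compose_poly:
  assumes "compact K" "continuous_on K \<phi>" "rational_approx K \<phi>"
  shows "rational_approx K (\<lambda>z. poly r (\<phi> z))"
  unfolding rational_approx_def
proof (intro allI impI)
  fix e :: real assume "e > 0"
  obtain B where B: "\<And>z. z \<in> K \<Longrightarrow> norm (\<phi> z) \<le> B"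
    using compact_imp_bounded[OF compact_continuous_image[OF assms(2,1)]] by (auto simp: bounded_iff)
  have "uniformly_continuous_on (cball 0 (B + 1)) (poly r)"
    by (intro compact_uniformly_continuous continuous_intros) auto
  then obtain d where d: "d > 0"
    "\<And>x y. x \<in> cball 0 (B + 1) \<Longrightarrow> y \<in> cball 0 (B + 1) \<Longrightarrow> dist x y < d \<Longrightarrow> dist (poly r x) (poly r y) < e"
    using \<open>e > 0\<close> unfolding uniformly_continuous_on_def by (metis dist_commute)
  have "min d 1 > 0" using d by simp
  then obtain p q where q: "\<And>z. z \<in> K \<Longrightarrow> poly q z \<noteq> 0"
    and pq: "\<And>z. z \<in> K \<Longrightarrow> norm (\<phi> z - poly p z / poly q z) < min d 1"
    using assms(3) unfolding rational_approx_def by metis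
  obtain s m where s: "\<forall>z. poly q z \<noteq> 0 \<longrightarrow> poly r (poly p z / poly q z) = poly s z / poly (q ^ m) z"
    using poly_of_quotient by blast
  have "norm (poly r (\<phi> z) - poly s z / poly (q ^ m) z) < e" if "z \<in> K" for z
  proof -
    have "norm (poly p z / poly q z) \<le> B + 1"
      using B[OF that] pq[OF that] norm_triangle_ineq2[of "poly p z / poly q z" "\<phi> z"]
      by (simp add: norm_minus_commute)
    then have "dist (poly r (\<phi> z)) (poly r (poly p z / poly q z)) < e"
      using B[OF that] pq[OF that] by (intro d(2)) (auto simp: dist_norm)
    then show ?thesis using s q[OF that] by (simp add: dist_norm)
  qed
  moreover have "\<forall>z\<in>K. poly (q ^ m) z \<noteq> 0" using q by simp
  ultimately show "\<exists>p q. (\<forall>z\<in>K. poly q z \<noteq> 0) \<and> (\<forall>z\<in>K. norm (poly r (\<phi> z) - poly p z / poly q z) < e)"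
    by blast
qed

lemma rational_approx_inverse:
  assumes "rational_approx K \<phi>" "d > 0" and d: "\<And>z. z \<in> K \<Longrightarrow> d \<le> norm (\<phi> z - w)"
  shows "rational_approx K (\<lambda>z. 1 / (\<phi> z - w))"
  unfolding rational_approx_def
proof (intro allI impI)
  fix e :: real assume "e > 0"
  have "min (d / 2) (e * (d * d / 2)) > 0" using \<open>d > 0\<close> \<open>e > 0\<close> by simp
  then obtain p q where q: "\<And>z. z \<in> K \<Longrightarrow> poly q z \<noteq> 0"
    and pq: "\<And>z. z \<in> K \<Longrightarrow> norm (\<phi> z - poly p z / poly q z) < min (d / 2) (e * (d * d / 2))"
    using assms(1) unfolding rational_approx_def by metis
  define s where "s = p - smult w q"
  have *: "poly s z \<noteq> 0 \<and> norm (1 / (\<phi> z - w) - poly q z / poly s z) < e" if "z \<in> K" for z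
  proof -
    define x y where "x = \<phi> z - w" and "y = poly p z / poly q z - w"
    have yx: "norm (x - y) < d / 2" "norm (x - y) < e * (d * d / 2)"
      using pq[OF that] by (auto simp: x_def y_def)
    have x: "norm x \<ge> d" using d[OF that] by (simp add: x_def)
    then have y: "norm y \<ge> d / 2" using yx(1) norm_triangle_ineq2[of x y] by linarith
    have ne: "x \<noteq> 0" "y \<noteq> 0" using x y \<open>d > 0\<close> by auto
    have sy: "poly s z = poly q z * y" using q[OF that] by (simp add: s_def y_def field_simps)
    have "1 / x - 1 / y = (y - x) / (x * y)" using ne by (simp add: divide_simps)
    then have "norm (1 / x - 1 / y) = norm (x - y) / (norm x * norm y)"
      by (simp add: norm_divide norm_mult norm_minus_commute)
    also have "\<dots> < (e * (d * d / 2)) / (norm x * norm y)"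
      using yx ne by (intro divide_strict_right_mono) auto
    also have "\<dots> \<le> (e * (d * d / 2)) / (d * (d / 2))"
      using x y \<open>d > 0\<close> \<open>e > 0\<close> by (intro divide_left_mono mult_mono mult_pos_pos) auto
    also have "\<dots> = e" using \<open>d > 0\<close> by simp
    finally show ?thesis using sy q[OF that] ne by (simp add: x_def)
  qed
  show "\<exists>p q. (\<forall>z\<in>K. poly q z \<noteq> 0) \<and> (\<forall>z\<in>K. norm (1 / (\<phi> z - w) - poly p z / poly q z) < e)"
    using * by blast
qed

lemma connected_complement_if_generator:
  assumes K: "compact K" and \<phi>: "continuous_on K \<phi>" "rational_approx K \<phi>"
    and gen: "R_algebra K = alg_closure K \<phi>"
  shows "connected (- \<phi> ` K)"
proof -
  define L where "L = \<phi> ` K"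
  have L: "compact L" unfolding L_def by (intro compact_continuous_image K \<phi>)
  have "inside L = {}"
  proof (rule ccontr)
    assume "inside L \<noteq> {}"
    then obtain w where w: "w \<in> inside L" by blast
    then have wL: "w \<notin> L" using inside_no_overlap by blast
    then obtain d where d: "d > 0" "\<And>x. x \<in> L \<Longrightarrow> d \<le> dist w x"
      using separate_point_closed[OF compact_imp_closed[OF L] wL] by blast
    have ne: "\<phi> z \<noteq> w" if "z \<in> K" for z using that wL by (auto simp: L_def)
    have "rational_approx K (\<lambda>z. 1 / (\<phi> z - w))"
    proof (rule rational_approx_inverse[OF \<phi>(2) d(1)])
      show "d \<le> norm (\<phi> z - w)" if "z \<in> K" for z
        using d(2)[of "\<phi> z"] that by (simp add: L_def dist_commute flip: dist_norm)
    qed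
    moreover have "continuous_on K (\<lambda>z. 1 / (\<phi> z - w))"
      using ne by (intro continuous_intros \<phi>) auto
    ultimately have "restrict (\<lambda>z. 1 / (\<phi> z - w)) K \<in> R_algebra K"
      unfolding R_algebra_iff[OF K] by (auto simp: rational_approx_def cong: continuous_on_cong_simp)
    then have alg: "\<exists>p. \<forall>z\<in>K. norm (1 / (\<phi> z - w) - poly p (\<phi> z)) < e" if "e > 0" for e
      unfolding gen alg_closure_iff[OF K \<phi>(1)] using that by (auto simp: restrict_def cong: ball_cong)
    obtain B where B: "B > 0" "\<And>x. x \<in> L \<Longrightarrow> norm (x - w) \<le> B"
    proof -
      have "bounded ((\<lambda>x. x - w) ` L)"
        by (intro compact_imp_bounded compact_continuous_image L continuous_intros)
      then show thesis using that by (auto simp: bounded_pos)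
    qed
    obtain p where p: "\<And>z. z \<in> K \<Longrightarrow> norm (1 / (\<phi> z - w) - poly p (\<phi> z)) < 1 / (2 * B)"
      using alg[of "1 / (2 * B)"] B by auto
    have small: "norm (1 - (x - w) * poly p x) \<le> 1 / 2" if "x \<in> L" for x
    proof -
      obtain z where z: "z \<in> K" "x = \<phi> z" using \<open>x \<in> L\<close> by (auto simp: L_def)
      have "1 - (x - w) * poly p x = (x - w) * (1 / (x - w) - poly p x)"
        using ne[OF z(1)] z(2) by (simp add: algebra_simps)
      also have "norm \<dots> \<le> B * (1 / (2 * B))"
        unfolding norm_mult using B(2)[OF that] p[OF z(1)] B(1) z(2) by (intro mult_mono) auto
      also have "\<dots> = 1 / 2" using B(1) by simp
      finally show ?thesis .
    qed
    have "norm (1 - (w - w) * poly p w) \<le> 1 / 2"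
    proof (rule maximum_modulus_frontier[of "\<lambda>x. 1 - (x - w) * poly p x" "inside L"])
      show "bounded (inside L)" using bounded_inside compact_imp_bounded[OF L] by blast
      show "norm (1 - (z - w) * poly p z) \<le> 1 / 2" if "z \<in> frontier (inside L)" for z
        using small that frontier_inside_subset[OF compact_imp_closed[OF L]] by blast
    qed (use w in \<open>auto intro!: holomorphic_intros continuous_intros\<close>)
    then show False by simp
  qed
  then have "- L = outside L" using inside_Un_outside[of L] by auto
  then show ?thesis
    using connected_outside[OF compact_imp_bounded[OF L]] by (simp add: L_def)
qed

lemma inj_on_if_generator:
  assumes K: "compact K" and \<phi>: "continuous_on K \<phi>" and gen: "R_algebra K = alg_closure K \<phi>"
  shows "inj_on \<phi> K"
proof (rule inj_onI, rule ccontr)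
  fix x y assume xy: "x \<in> K" "y \<in> K" "\<phi> x = \<phi> y" "x \<noteq> y"
  have "rational_approx K (restrict (\<lambda>z. z) K)"
    unfolding rational_approx_def by (intro allI impI exI[of _ "[:0, 1:]"] exI[of _ 1]) simp
  then have "restrict (\<lambda>z. z) K \<in> R_algebra K"
    unfolding R_algebra_iff[OF K] by (auto cong: continuous_on_cong_simp)
  moreover have "dist x y / 2 > 0" using xy by simp
  ultimately obtain p where p: "\<And>z. z \<in> K \<Longrightarrow> norm (z - poly p (\<phi> z)) < dist x y / 2"
    unfolding gen alg_closure_iff[OF K \<phi>] by (metis restrict_apply')
  have "norm ((x - poly p (\<phi> x)) - (y - poly p (\<phi> y))) < dist x y / 2 + dist x y / 2"
    by (intro order_le_less_trans[OF norm_triangle_ineq4] add_strict_mono p xy)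
  then show False using xy by (simp add: dist_norm)
qed

lemma inverse_holomorphic_on_interior:
  fixes \<phi> \<psi> :: "complex \<Rightarrow> complex"
  assumes hom: "homeomorphism K L \<phi> \<psi>" and hol: "\<phi> holomorphic_on interior K"
  shows "\<psi> holomorphic_on interior L" "\<psi> ` interior L \<subseteq> interior K"
proof -
  have inj: "inj_on \<phi> K" "inj_on \<psi> L"
    using hom unfolding homeomorphism_def by (metis inj_on_inverseI)+
  have "open (\<psi> ` interior L)"
    using hom interior_subset[of L] inj(2)
    by (intro invariance_of_domain) (auto simp: homeomorphism_def intro: continuous_on_subset inj_on_subset)
  moreover have "\<psi> ` interior L \<subseteq> K"
    using hom interior_subset[of L] by (auto simp: homeomorphism_def)
  ultimately show sub: "\<psi> ` interior L \<subseteq> interior K" by (rule interior_maximal[rotated])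
  obtain g where g: "g holomorphic_on (\<phi> ` interior K)" "\<And>z. z \<in> interior K \<Longrightarrow> g (\<phi> z) = z"
    using holomorphic_has_inverse[OF hol open_interior inj_on_subset[OF inj(1) interior_subset]] by metis
  have \<phi>\<psi>: "\<phi> (\<psi> x) = x" if "x \<in> interior L" for x
    by (rule homeomorphism_apply2[OF hom subsetD[OF interior_subset that]])
  show "\<psi> holomorphic_on interior L"
  proof (rule holomorphic_transform)
    have "interior L \<subseteq> \<phi> ` interior K" using sub \<phi>\<psi> by (metis imageI image_subset_iff subsetI)
    then show "g holomorphic_on interior L" using g(1) holomorphic_on_subset by blast
    show "g x = \<psi> x" if "x \<in> interior L" for x
      using g(2)[of "\<psi> x"] sub \<phi>\<psi>[OF that] that by auto
  qed
qed

lemma generator_if_homeomorphism: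
  assumes K: "compact K" "connected (- K)" and \<phi>: "\<phi> \<in> R_algebra K"
    and hom: "homeomorphism K (\<phi> ` K) \<phi> \<psi>"
  shows "R_algebra K = alg_closure K \<phi>"
proof
  have c: "continuous_on K \<phi>" and r: "rational_approx K \<phi>"
    using \<phi> by (auto simp: R_algebra_iff[OF K(1)])
  define L where "L = \<phi> ` K"
  have L: "compact L" unfolding L_def by (intro compact_continuous_image K c)
  have "K homeomorphic L" using hom by (auto simp: homeomorphic_def L_def)
  then have "connected (- L)"
    using homeomorphic_Borsukian_eq[of K L] Borsukian_separation_compact K L by blast
  have \<psi>: "continuous_on L \<psi>" "\<psi> ` L = K" "\<And>z. z \<in> K \<Longrightarrow> \<psi> (\<phi> z) = z"
    using hom by (auto simp: homeomorphism_def L_def)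
  note inv = inverse_holomorphic_on_interior[OF hom[folded L_def] rational_approx_holomorphic[OF r]]
  show "R_algebra K \<subseteq> alg_closure K \<phi>"
  proof
    fix f assume "f \<in> R_algebra K"
    then have f: "f \<in> extensional K" "continuous_on K f" "rational_approx K f"
      by (auto simp: R_algebra_iff[OF K(1)])
    have "poly_approx L (f \<circ> \<psi>)"
    proof (rule mergelyan[OF L \<open>connected (- L)\<close>])
      show "continuous_on L (f \<circ> \<psi>)" using \<psi> f by (intro continuous_on_compose) auto
      show "f \<circ> \<psi> holomorphic_on interior L"
        using inv rational_approx_holomorphic[OF f(3)] by (intro holomorphic_on_compose_gen) auto
    qed
    then have "\<exists>p. \<forall>z\<in>K. norm (f z - poly p (\<phi> z)) < e" if "e > 0" for e
      using that \<psi>(3) unfolding poly_approx_def L_def by (metis comp_apply image_eqI)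
    then show "f \<in> alg_closure K \<phi>" using f by (simp add: alg_closure_iff[OF K(1) c])
  qed
  show "alg_closure K \<phi> \<subseteq> R_algebra K"
  proof
    fix f assume "f \<in> alg_closure K \<phi>"
    then have f: "f \<in> extensional K" "continuous_on K f"
      and app: "\<And>e. e > 0 \<Longrightarrow> \<exists>p. \<forall>z\<in>K. norm (f z - poly p (\<phi> z)) < e"
      by (auto simp: alg_closure_iff[OF K(1) c])
    have "rational_approx K f"
      unfolding rational_approx_def
    proof (intro allI impI)
      fix e :: real assume "e > 0"
      then obtain r' where r': "\<forall>z\<in>K. norm (f z - poly r' (\<phi> z)) < e / 2"
        using app half_gt_zero by blast
      obtain p q where q: "\<forall>z\<in>K. poly q z \<noteq> 0"
        and pq: "\<forall>z\<in>K. norm (poly r' (\<phi> z) - poly p z / poly q z) < e / 2"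
        using rational_approx_compose_poly[OF K(1) c r, of r'] half_gt_zero[OF \<open>e > 0\<close>]
        unfolding rational_approx_def by metis
      have "\<forall>z\<in>K. norm (f z - poly p z / poly q z) < e"
        using r' pq by (metis norm_diff_triangle_less field_sum_of_halves)
      with q show "\<exists>p q. (\<forall>z\<in>K. poly q z \<noteq> 0) \<and> (\<forall>z\<in>K. norm (f z - poly p z / poly q z) < e)"
        by blast
    qed
    then show "f \<in> R_algebra K" using f by (simp add: R_algebra_iff[OF K(1)])
  qed
qed

theorem theorem1p5:
  fixes K :: "complex set" and \<phi> :: "complex \<Rightarrow> complex"
  assumes "compact K" and "\<phi> \<in> R_algebra K"
  shows "generator_of_R K \<phi> \<longleftrightarrow>
    (\<exists>\<psi>. homeomorphism K (\<phi> ` K) \<phi> \<psi>) \<and> connected (- K)"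
proof
  have \<phi>: "continuous_on K \<phi>" "rational_approx K \<phi>"
    using assms by (auto simp: R_algebra_iff)
  assume "generator_of_R K \<phi>"
  then have gen: "R_algebra K = alg_closure K \<phi>" by (simp add: generator_of_R_def)
  obtain \<psi> where \<psi>: "homeomorphism K (\<phi> ` K) \<phi> \<psi>"
    using homeomorphism_compact[OF assms(1) \<phi>(1) refl inj_on_if_generator[OF assms(1) \<phi>(1) gen]] by blast
  have "K homeomorphic \<phi> ` K" using \<psi> by (auto simp: homeomorphic_def)
  moreover have "connected (- \<phi> ` K)"
    by (rule connected_complement_if_generator[OF assms(1) \<phi> gen])
  ultimately have "connected (- K)"
    using homeomorphic_Borsukian_eq Borsukian_separation_compact assms(1)
      compact_continuous_image[OF \<phi>(1) assms(1)] by blast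
  with \<psi> show "(\<exists>\<psi>. homeomorphism K (\<phi> ` K) \<phi> \<psi>) \<and> connected (- K)" by blast
next
  assume "(\<exists>\<psi>. homeomorphism K (\<phi> ` K) \<phi> \<psi>) \<and> connected (- K)"
  then show "generator_of_R K \<phi>"
    using generator_if_homeomorphism[OF assms(1) _ assms(2)] by (auto simp: generator_of_R_def)
qed

end
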